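(* Let $\psi:N_0\times_{\rho_1}N_1\times\cdots\times_{\rho_k}N_k\to\mathbb{E}^n_\nu$ be the proper warped product decomposition of $\mathbb{E}^n_\nu$ associated with initial data $(\bar p;V_0\oplus V_1\oplus\cdots\oplus V_k;a_1,\dots,a_k)$ which is in canonical form. Suppose $\kappa^{-1}:=\bar p^2\ne0$, and let $N':=N_0(\kappa)\times_{\rho_1}N_1\times\cdots\times_{\rho_k}N_k$, where $N_0(\kappa):=\{p\in N_0:p^2=\kappa^{-1}\}$ (and the $\rho_i$ are restricted to $N_0(\kappa)$). Then $N_0(\kappa)$ is an open subset of the sphere in $\mathbb{E}^n_\nu(\kappa)$ determined by $(\bar p,\bar p^\perp\cap V_0,\kappa\bar p)$, and $\phi:=\psi|_{N'}$ is a warped product decomposition $\phi:N'\to\mathbb{E}^n_\nu(\kappa)$ of $\mathbb{E}^n_\nu(\kappa)$ determined by $(\bar p;(\bar p^\perp\cap V_0)\oplus V_1\oplus\cdots\oplus V_k;a_1,\dots,a_k)$. Furthermore, for any point $p\in\operatorname{Im}(\psi)$ with $p^2\ne0$ and each $i\ge1$, the leaf $L_i(p)$ through $p$ of the foliation induced by $N_i$ is simultaneously a sphere in $\mathbb{E}^n_\nu$ and in $\mathbb{E}^n_\nu(1/p^2)$. Also, $\psi$ is in canonical form at every $p\in\operatorname{Im}(\psi)$.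
   Context: $\mathbb{E}^n_\nu$ denotes pseudo-Euclidean space: an $n$-dimensional real vector space with a non-degenerate symmetric bilinear form $\langle\cdot,\cdot\rangle$ having $\nu$ negative diagonal entries in a diagonalizing basis; $n\ge2$; $x^2:=\langle x,x\rangle$. Tangent vectors are identified with vectors of $\mathbb{E}^n_\nu$. For $\kappa\ne0$, $\mathbb{E}^n_\nu(\kappa):=\{p\in\mathbb{E}^n_\nu:\langle p,p\rangle=\kappa^{-1}\}$ with the induced metric. A pseudo-Riemannian submanifold is spherical (a sphere) if its second fundamental form is $h(X,Y)=\langle X,Y\rangle H$ with mean curvature normal $H$ parallel in the normal connection. The warped product $M_0\times_{\rho_1}M_1\times\cdots\times_{\rho_k}M_k$ of pseudo-Riemannian manifolds $(M_i,g_i)$, $\dim M_i>0$ for $i>0$, with $\rho_i:M_0\to\mathbb{R}^+$, is the product manifold with metric $\pi_0^*g_0+\sum_{i\geq 1}\rho_i^2\pi_i^*g_i$, where $\pi_i$ are the projections. A warped product decomposition of $M$ is a warped product together with an isometry of it onto a non-empty open subset of $M$. The factor $M_i$ induces a foliation, whose leaf $L_i(\cdot)$ through a point is obtained by varying the $i$-th coordinate and fixing the others (transported by the isometry). Initial data for a proper warped product decomposition of $\mathbb{E}^n_\nu$: a point $\bar p$, an orthogonal decomposition $T_{\bar p}\mathbb{E}^n_\nu=V_0\oplus\cdots\oplus V_k$ into non-trivial (hence non-degenerate) subspaces, $k\ge1$, and pairwise orthogonal, linearly independent vectors $a_1,\dots,a_k\in V_0$. The associated decomposition is $\psi(p_0,\dots,p_k)=p_0+\sum_{i=1}^k\rho_i(p_0)(p_i-\bar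 p)$ on $N_0\times_{\rho_1}N_1\times\cdots\times_{\rho_k}N_k$, where $\rho_i(p_0)=1+\langle a_i,p_0-\bar p\rangle$, $N_0=\{p_0\in\bar p+V_0:\rho_i(p_0)>0\ \forall i\}$, and for $i\ge1$, $N_i$ is the sphere in $\mathbb{E}^n_\nu$ determined by $(\bar p,V_i,a_i)$. It is in canonical form if $\bar p\in V_0$ and $\langle\bar p,a_i\rangle=1$ for all $i$ (then $\rho_i(p_0)=\langle a_i,p_0\rangle$ and $N_0=\{p\in V_0:\langle a_i,p\rangle>0\ \forall i\}$). For $p\in\operatorname{Im}(\psi)$, "$\psi$ is in canonical form at $p$" means that the same two conditions hold for the data of $\psi$ at $p$: $p\in T_pL_0(p)$, and $\langle p,-H_i|_p\rangle=1$ for every $i\ge1$, where $H_i|_p$ is the mean curvature vector of $L_i(p)$ in $\mathbb{E}^n_\nu$ at $p$ (at $p=\bar p$ one has $T_{\bar p}L_0(\bar p)=V_0$ and $-H_i|_{\bar p}=a_i$). The sphere determined by $(\bar p,V,a)$, $a\in V^\perp$, $a\ne0$: if $\tilde\kappa:=a^2\ne0$ it is $(\bar p-\frac{a}{\tilde\kappa})+\{p\in\mathbb{R}a\oplus V:p^2=1/\tilde\kappa\}$; if $a$ is lightlike it is $\bar p+\{p-\frac12p^2a:p\in V\}$. When $\bar p\in\mathbb{E}^n_\nu(\kappa)$, $V\subset T_{\bar p}\mathbb{E}^n_\nu(\kappa)$ and $a=\kappa\bar p-z$ with $z\in V^\perp\cap T_{\bar p}\mathbb{E}^n_\nu(\kappa)$,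 this same set is called the sphere in $\mathbb{E}^n_\nu(\kappa)$ determined by $(\bar p,V,a)$ (mean curvature vector $z$ in $\mathbb{E}^n_\nu(\kappa)$ at $\bar p$). A warped product decomposition of $\mathbb{E}^n_\nu(\kappa)$ is determined by $(\bar p;U_0\oplus U_1\oplus\cdots\oplus U_k;a_1,\dots,a_k)$ if $\bar p$ lies in its image, $T_{\bar p}L_i(\bar p)=U_i$ for $i=0,\dots,k$, and for $i\ge1$ the leaf $L_i(\bar p)$ has mean curvature vector $\kappa\bar p-a_i$ in $\mathbb{E}^n_\nu(\kappa)$ at $\bar p$. *)

theory Defs
  imports "HOL-Analysis.Analysis"
begin

section \<open>Smooth maps and embedded submanifolds\<close>

primrec Ck_on :: "nat \<Rightarrow> 'a::euclidean_space set \<Rightarrow> ('a \<Rightarrow> 'b::euclidean_space) \<Rightarrow> bool" where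
  "Ck_on 0 S f \<longleftrightarrow> continuous_on S f"
| "Ck_on (Suc k) S f \<longleftrightarrow>
     (\<forall>x\<in>S. f differentiable (at x)) \<and>
     (\<forall>v. Ck_on k S (\<lambda>x. frechet_derivative f (at x) v))"

text \<open>Meant for open \<open>S\<close> only.\<close>

definition smooth_on :: "'a::euclidean_space set \<Rightarrow> ('a \<Rightarrow> 'b::euclidean_space) \<Rightarrow> bool" where
  "smooth_on S f \<longleftrightarrow> (\<forall>k. Ck_on k S f)"

definition slice_chart ::
  "nat \<Rightarrow> 'a::euclidean_space set \<Rightarrow> 'a set \<Rightarrow> ('a \<Rightarrow> 'a) \<Rightarrow> bool" where
  "slice_chart m M U \<Phi> \<longleftrightarrow>
     open U \<and> smooth_on U \<Phi> \<and> inj_on \<Phi> U \<and>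
     open (\<Phi> ` U) \<and> smooth_on (\<Phi> ` U) (inv_into U \<Phi>) \<and>
     (\<exists>S. subspace S \<and> dim S = m \<and> \<Phi> ` (M \<inter> U) = S \<inter> \<Phi> ` U)"

definition submanifold :: "nat \<Rightarrow> 'a::euclidean_space set \<Rightarrow> bool" where
  "submanifold m M \<longleftrightarrow> (\<forall>p\<in>M. \<exists>U \<Phi>. p \<in> U \<and> slice_chart m M U \<Phi>)"

definition tangent_space :: "'a::euclidean_space set \<Rightarrow> 'a \<Rightarrow> 'a set" where
  "tangent_space M p =
     {v. \<exists>(\<gamma>::real \<Rightarrow> 'a) \<epsilon>. \<epsilon> > 0 \<and> smooth_on {-\<epsilon><..<\<epsilon>} \<gamma> \<and> \<gamma> ` {-\<epsilon><..<\<epsilon>} \<subseteq> M \<and>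
        \<gamma> 0 = p \<and> (\<gamma> has_vector_derivative v) (at 0)}"

definition local_extension ::
  "'a::euclidean_space set \<Rightarrow> ('a \<Rightarrow> 'b::euclidean_space) \<Rightarrow> 'a \<Rightarrow> ('a \<Rightarrow> 'b) \<Rightarrow> bool" where
  "local_extension P f x F \<longleftrightarrow>
     (\<exists>U. open U \<and> x \<in> U \<and> smooth_on U F \<and> (\<forall>y\<in>P \<inter> U. F y = f y))"

definition smooth_map ::
  "'a::euclidean_space set \<Rightarrow> ('a \<Rightarrow> 'b::euclidean_space) \<Rightarrow> bool" where
  "smooth_map P f \<longleftrightarrow> (\<forall>x\<in>P. \<exists>F. local_extension P f x F)"

text \<open>On vectors tangent to \<open>P\<close> the value does not depend on the chosen extension.\<close>

definition differential ::
  "'a::euclidean_space set \<Rightarrow> ('a \<Rightarrow> 'b::euclidean_space) \<Rightarrow> 'a \<Rightarrow> 'a \<Rightarrow> 'b" where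
  "differential P f x X = frechet_derivative (SOME F. local_extension P f x F) (at x) X"


section \<open>Pseudo-Euclidean spaces and their submanifolds\<close>

text \<open>
  A pseudo-Euclidean space is a type of class \<open>euclidean_space\<close> together with a form \<open>B\<close>.
  The inner product of the class is not used; the class only provides the topology and the
  smooth structure of a finite-dimensional real vector space.
\<close>

definition nondegenerate_on :: "('a::real_vector \<Rightarrow> 'a \<Rightarrow> real) \<Rightarrow> 'a set \<Rightarrow> bool" where
  "nondegenerate_on B S \<longleftrightarrow> (\<forall>x\<in>S. (\<forall>y\<in>S. B x y = 0) \<longrightarrow> x = 0)"

definition pseudo_euclidean :: "nat \<Rightarrow> ('a::euclidean_space \<Rightarrow> 'a \<Rightarrow> real) \<Rightarrow> bool" where
  "pseudo_euclidean \<nu> B \<longleftrightarrow>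
     bilinear B \<and> (\<forall>x y. B x y = B y x) \<and> nondegenerate_on B UNIV \<and>
     (\<exists>b. independent b \<and> span b = UNIV \<and>
        (\<forall>x\<in>b. \<forall>y\<in>b. x \<noteq> y \<longrightarrow> B x y = 0) \<and> card {x\<in>b. B x x < 0} = \<nu>)"

definition hyperquadric :: "('a::euclidean_space \<Rightarrow> 'a \<Rightarrow> real) \<Rightarrow> real \<Rightarrow> 'a set" where
  "hyperquadric B \<kappa> = {p. B p p = inverse \<kappa>}"

definition orth :: "('a::euclidean_space \<Rightarrow> 'a \<Rightarrow> real) \<Rightarrow> 'a set \<Rightarrow> 'a set" where
  "orth B S = {v. \<forall>u\<in>S. B v u = 0}"

definition orthogonal_decomposition ::
  "('a::euclidean_space \<Rightarrow> 'a \<Rightarrow> real) \<Rightarrow> ('j::finite \<Rightarrow> 'a set) \<Rightarrow> 'a set \<Rightarrow> bool" where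
  "orthogonal_decomposition B V T \<longleftrightarrow>
     (\<forall>j. subspace (V j) \<and> V j \<subseteq> T) \<and>
     (\<forall>j l. j \<noteq> l \<longrightarrow> (\<forall>x\<in>V j. \<forall>y\<in>V l. B x y = 0)) \<and>
     (\<forall>x\<in>T. \<exists>!v. (\<forall>j. v j \<in> V j) \<and> x = (\<Sum>j\<in>UNIV. v j))"

text \<open>Well defined if \<open>B\<close> is non-degenerate on the subspace \<open>S\<close>.\<close>

definition orth_proj :: "('a::euclidean_space \<Rightarrow> 'a \<Rightarrow> real) \<Rightarrow> 'a set \<Rightarrow> 'a \<Rightarrow> 'a" where
  "orth_proj B S v = (THE w. w \<in> S \<and> v - w \<in> orth B S)"

definition pr_submanifold ::
  "('a::euclidean_space \<Rightarrow> 'a \<Rightarrow> real) \<Rightarrow> nat \<Rightarrow> 'a set \<Rightarrow> bool" where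
  "pr_submanifold B m M \<longleftrightarrow>
     submanifold m M \<and> (\<forall>p\<in>M. nondegenerate_on B (tangent_space M p))"


section \<open>Second fundamental form, mean curvature and spherical submanifolds\<close>

text \<open>
  Throughout, \<open>M \<subseteq> N\<close> are pseudo-Riemannian submanifolds of the pseudo-Euclidean space, and
  \<open>M\<close> is regarded as a submanifold of \<open>N\<close>; \<open>N = UNIV\<close> is the pseudo-Euclidean space itself.
  The Levi-Civita connection of \<open>N\<close> is the part of the flat connection tangent to \<open>N\<close>, so
  normal components in \<open>N\<close> are projections of flat derivatives to \<open>T\<^sub>pN \<inter> (T\<^sub>pM)\<^sup>\<bottom>\<close>.
\<close>

definition normal_space ::
  "('a::euclidean_space \<Rightarrow> 'a \<Rightarrow> real) \<Rightarrow> 'a set \<Rightarrow> 'a set \<Rightarrow> 'a \<Rightarrow> 'a set" where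
  "normal_space B N M p = tangent_space N p \<inter> orth B (tangent_space M p)"

definition tangent_field_extending ::
  "'a::euclidean_space set \<Rightarrow> 'a \<Rightarrow> 'a \<Rightarrow> ('a \<Rightarrow> 'a) \<Rightarrow> bool" where
  "tangent_field_extending M p Y W \<longleftrightarrow>
     (\<exists>U. open U \<and> p \<in> U \<and> smooth_on U W \<and> (\<forall>q\<in>M \<inter> U. W q \<in> tangent_space M q)) \<and> W p = Y"

text \<open>For \<open>X\<close> and \<open>Y\<close> tangent to \<open>M\<close> the value does not depend on the chosen extension of \<open>Y\<close>.\<close>

definition second_fundamental_form ::
  "('a::euclidean_space \<Rightarrow> 'a \<Rightarrow> real) \<Rightarrow> 'a set \<Rightarrow> 'a set \<Rightarrow> 'a \<Rightarrow> 'a \<Rightarrow> 'a \<Rightarrow> 'a" where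
  "second_fundamental_form B N M p X Y =
     orth_proj B (normal_space B N M p)
       (frechet_derivative (SOME W. tangent_field_extending M p Y W) (at p) X)"

definition orthonormal_basis_of ::
  "('a::euclidean_space \<Rightarrow> 'a \<Rightarrow> real) \<Rightarrow> 'a set \<Rightarrow> 'a set \<Rightarrow> bool" where
  "orthonormal_basis_of B T b \<longleftrightarrow>
     b \<subseteq> T \<and> independent b \<and> span b = T \<and>
     (\<forall>e\<in>b. \<bar>B e e\<bar> = 1) \<and> (\<forall>e\<in>b. \<forall>f\<in>b. e \<noteq> f \<longrightarrow> B e f = 0)"

text \<open>The metric trace of the second fundamental form, divided by the dimension.\<close>

definition mean_curvature ::
  "('a::euclidean_space \<Rightarrow> 'a \<Rightarrow> real) \<Rightarrow> 'a set \<Rightarrow> 'a set \<Rightarrow> 'a \<Rightarrow> 'a" where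
  "mean_curvature B N M p =
     (1 / real (dim (tangent_space M p))) *\<^sub>R
     (\<Sum>e\<in>(SOME b. orthonormal_basis_of B (tangent_space M p) b).
        B e e *\<^sub>R second_fundamental_form B N M p e e)"

definition parallel_normal_field ::
  "('a::euclidean_space \<Rightarrow> 'a \<Rightarrow> real) \<Rightarrow> 'a set \<Rightarrow> 'a set \<Rightarrow> ('a \<Rightarrow> 'a) \<Rightarrow> bool" where
  "parallel_normal_field B N M \<xi> \<longleftrightarrow>
     smooth_map M \<xi> \<and>
     (\<forall>p\<in>M. \<xi> p \<in> normal_space B N M p) \<and>
     (\<forall>p\<in>M. \<forall>X\<in>tangent_space M p. orth_proj B (normal_space B N M p) (differential M \<xi> p X) = 0)"

definition spherical ::
  "('a::euclidean_space \<Rightarrow> 'a \<Rightarrow> real) \<Rightarrow> 'a set \<Rightarrow> 'a set \<Rightarrow> bool" where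
  "spherical B N M \<longleftrightarrow>
     M \<subseteq> N \<and> (\<exists>m. pr_submanifold B m N) \<and> (\<exists>m. pr_submanifold B m M) \<and>
     (\<forall>p\<in>M. \<forall>X\<in>tangent_space M p. \<forall>Y\<in>tangent_space M p.
        second_fundamental_form B N M p X Y = B X Y *\<^sub>R mean_curvature B N M p) \<and>
     parallel_normal_field B N M (mean_curvature B N M)"

text \<open>Only used for \<open>a \<noteq> 0\<close> orthogonal to the subspace \<open>V\<close>.\<close>

definition determined_sphere ::
  "('a::euclidean_space \<Rightarrow> 'a \<Rightarrow> real) \<Rightarrow> 'a \<Rightarrow> 'a set \<Rightarrow> 'a \<Rightarrow> 'a set" where
  "determined_sphere B pbar V a =
     (if B a a \<noteq> 0
      then (\<lambda>p. (pbar - (1 / B a a) *\<^sub>R a) + p) ` {p \<in> span (insert a V). B p p = 1 / B a a}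
      else (\<lambda>p. pbar + (p - (B p p / 2) *\<^sub>R a)) ` V)"

text \<open>
  The set \<open>determined_sphere B pbar V a\<close> is called the sphere in \<open>hyperquadric B \<kappa>\<close> determined
  by the data exactly if the following holds.
\<close>

definition hyperquadric_sphere_data ::
  "('a::euclidean_space \<Rightarrow> 'a \<Rightarrow> real) \<Rightarrow> real \<Rightarrow> 'a \<Rightarrow> 'a set \<Rightarrow> 'a \<Rightarrow> bool" where
  "hyperquadric_sphere_data B \<kappa> pbar V a \<longleftrightarrow>
     pbar \<in> hyperquadric B \<kappa> \<and> subspace V \<and> V \<subseteq> tangent_space (hyperquadric B \<kappa>) pbar \<and> a \<noteq> 0 \<and>
     (\<exists>z \<in> orth B V \<inter> tangent_space (hyperquadric B \<kappa>) pbar. a = \<kappa> *\<^sub>R pbar - z)"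


section \<open>Warped products\<close>

text \<open>
  The factors \<open>M\<^sub>0, \<dots>, M\<^sub>k\<close> are indexed by \<open>'i option\<close> with \<open>k = CARD('i)\<close>, which is at least 1:
  \<open>None\<close> is the index 0, and the indices \<open>i \<ge> 1\<close> are the \<open>Some i\<close>. All factors are submanifolds
  of one pseudo-Euclidean space with the induced metrics, so their product is a subset of
  \<open>'a ^ 'i option\<close>.
\<close>

definition product_manifold ::
  "('i::finite option \<Rightarrow> 'a::euclidean_space set) \<Rightarrow> ('a ^ 'i option) set" where
  "product_manifold M = {x. \<forall>j. x $ j \<in> M j}"

definition warped_metric ::
  "('a::euclidean_space \<Rightarrow> 'a \<Rightarrow> real) \<Rightarrow> ('i::finite \<Rightarrow> 'a \<Rightarrow> real) \<Rightarrow>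
   'a ^ 'i option \<Rightarrow> 'a ^ 'i option \<Rightarrow> 'a ^ 'i option \<Rightarrow> real" where
  "warped_metric B \<rho> x X Y =
     B (X $ None) (Y $ None) + (\<Sum>i\<in>UNIV. (\<rho> i (x $ None))\<^sup>2 * B (X $ Some i) (Y $ Some i))"

definition isometry_onto_open ::
  "('b::euclidean_space \<Rightarrow> 'b \<Rightarrow> 'b \<Rightarrow> real) \<Rightarrow> 'b set \<Rightarrow>
   ('a::euclidean_space \<Rightarrow> 'a \<Rightarrow> real) \<Rightarrow> 'a set \<Rightarrow> ('b \<Rightarrow> 'a) \<Rightarrow> bool" where
  "isometry_onto_open g P B Q f \<longleftrightarrow>
     f ` P \<noteq> {} \<and> openin (top_of_set Q) (f ` P) \<and>
     inj_on f P \<and> smooth_map P f \<and> smooth_map (f ` P) (inv_into P f) \<and>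
     (\<forall>x\<in>P. \<forall>X\<in>tangent_space P x. \<forall>Y\<in>tangent_space P x.
        B (differential P f x X) (differential P f x Y) = g x X Y)"

definition warped_product_decomposition ::
  "('a::euclidean_space \<Rightarrow> 'a \<Rightarrow> real) \<Rightarrow> ('i::finite option \<Rightarrow> 'a set) \<Rightarrow> ('i \<Rightarrow> 'a \<Rightarrow> real) \<Rightarrow>
   'a set \<Rightarrow> ('a ^ 'i option \<Rightarrow> 'a) \<Rightarrow> bool" where
  "warped_product_decomposition B M \<rho> Q f \<longleftrightarrow>
     (\<exists>m. pr_submanifold B m Q) \<and>
     (\<exists>m. pr_submanifold B m (M None)) \<and>
     (\<forall>i. \<exists>m>0. pr_submanifold B m (M (Some i))) \<and>
     (\<forall>i. smooth_map (M None) (\<rho> i) \<and> (\<forall>p\<in>M None. \<rho> i p > 0)) \<and>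
     isometry_onto_open (warped_metric B \<rho>) (product_manifold M) B Q f"

definition leaf ::
  "('i::finite option \<Rightarrow> 'a::euclidean_space set) \<Rightarrow> ('a ^ 'i option \<Rightarrow> 'a) \<Rightarrow>
   'i option \<Rightarrow> 'a \<Rightarrow> 'a set" where
  "leaf M f j p =
     {f y | x y. x \<in> product_manifold M \<and> f x = p \<and>
                 y \<in> product_manifold M \<and> (\<forall>l. l \<noteq> j \<longrightarrow> y $ l = x $ l)}"

definition hyperquadric_decomposition_determined_by ::
  "('a::euclidean_space \<Rightarrow> 'a \<Rightarrow> real) \<Rightarrow> real \<Rightarrow>
   ('i::finite option \<Rightarrow> 'a set) \<Rightarrow> ('a ^ 'i option \<Rightarrow> 'a) \<Rightarrow>
   'a \<Rightarrow> ('i option \<Rightarrow> 'a set) \<Rightarrow> ('i \<Rightarrow> 'a) \<Rightarrow> bool" where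
  "hyperquadric_decomposition_determined_by B \<kappa> M f pbar U a \<longleftrightarrow>
     orthogonal_decomposition B U (tangent_space (hyperquadric B \<kappa>) pbar) \<and>
     pbar \<in> f ` product_manifold M \<and>
     (\<forall>j. tangent_space (leaf M f j pbar) pbar = U j) \<and>
     (\<forall>i. mean_curvature B (hyperquadric B \<kappa>) (leaf M f (Some i) pbar) pbar = \<kappa> *\<^sub>R pbar - a i)"


section \<open>Proper warped product decompositions of pseudo-Euclidean space\<close>

definition initial_data ::
  "('a::euclidean_space \<Rightarrow> 'a \<Rightarrow> real) \<Rightarrow> 'a \<Rightarrow> ('i::finite option \<Rightarrow> 'a set) \<Rightarrow> ('i \<Rightarrow> 'a) \<Rightarrow> bool" where
  "initial_data B pbar V a \<longleftrightarrow>
     orthogonal_decomposition B V (tangent_space UNIV pbar) \<and> (\<forall>j. V j \<noteq> {0}) \<and>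
     (\<forall>i. a i \<in> V None) \<and> inj a \<and> independent (range a) \<and>
     (\<forall>i l. i \<noteq> l \<longrightarrow> B (a i) (a l) = 0)"

definition canonical_form ::
  "('a::euclidean_space \<Rightarrow> 'a \<Rightarrow> real) \<Rightarrow> 'a \<Rightarrow> ('i::finite option \<Rightarrow> 'a set) \<Rightarrow> ('i \<Rightarrow> 'a) \<Rightarrow> bool" where
  "canonical_form B pbar V a \<longleftrightarrow> pbar \<in> V None \<and> (\<forall>i. B pbar (a i) = 1)"

definition warp ::
  "('a::euclidean_space \<Rightarrow> 'a \<Rightarrow> real) \<Rightarrow> 'a \<Rightarrow> ('i::finite \<Rightarrow> 'a) \<Rightarrow> 'i \<Rightarrow> 'a \<Rightarrow> real" where
  "warp B pbar a i p = 1 + B (a i) (p - pbar)"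

definition factors ::
  "('a::euclidean_space \<Rightarrow> 'a \<Rightarrow> real) \<Rightarrow> 'a \<Rightarrow> ('i::finite option \<Rightarrow> 'a set) \<Rightarrow> ('i \<Rightarrow> 'a) \<Rightarrow>
   'i option \<Rightarrow> 'a set" where
  "factors B pbar V a j =
     (case j of
        None \<Rightarrow> {p. p - pbar \<in> V None \<and> (\<forall>i. warp B pbar a i p > 0)}
      | Some i \<Rightarrow> determined_sphere B pbar (V (Some i)) (a i))"

definition associated_map ::
  "('a::euclidean_space \<Rightarrow> 'a \<Rightarrow> real) \<Rightarrow> 'a \<Rightarrow> ('i::finite \<Rightarrow> 'a) \<Rightarrow> 'a ^ 'i option \<Rightarrow> 'a" where
  "associated_map B pbar a x =
     x $ None + (\<Sum>i\<in>UNIV. warp B pbar a i (x $ None) *\<^sub>R (x $ Some i - pbar))"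

text \<open>The two conditions of \<^const>\<open>canonical_form\<close> for the data at \<open>p\<close> of a decomposition.\<close>

definition canonical_form_at ::
  "('a::euclidean_space \<Rightarrow> 'a \<Rightarrow> real) \<Rightarrow> ('i::finite option \<Rightarrow> 'a set) \<Rightarrow>
   ('a ^ 'i option \<Rightarrow> 'a) \<Rightarrow> 'a \<Rightarrow> bool" where
  "canonical_form_at B M f p \<longleftrightarrow>
     p \<in> tangent_space (leaf M f None p) p \<and>
     (\<forall>i. B p (- mean_curvature B UNIV (leaf M f (Some i) p) p) = 1)"

end

theory Submission
  imports Defs
begin

text \<open>
  In canonical form every factor \<open>N\<^sub>i\<close> and every leaf of the foliation it induces is a slice
  \<open>{x. x - p \<in> W \<and> x\<^sup>2 = p\<^sup>2}\<close> of a central quadric by an affine subspace, where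
  \<open>W = \<real>a\<^sub>i \<oplus> V\<^sub>i\<close>; so is the hyperquadric itself (\<open>W = UNIV\<close>), and \<open>N\<^sub>0(\<kappa>)\<close> is the open
  part of such a slice (\<open>W = V\<^sub>0\<close>) on which all \<open>\<langle>a\<^sub>i,\<cdot>\<rangle>\<close> are positive.
  If \<open>e \<in> W\<close> is orthogonal to \<open>W \<inter> p\<^sup>\<bottom>\<close> and \<open>\<langle>p,e\<rangle> = 1\<close>, then \<open>e\<^sub>x = e + e\<^sup>2(x - p)\<close>
  plays the same role at every other point \<open>x\<close> of the slice, and differentiating
  \<open>\<langle>x, Y\<rangle> = 0\<close> along the slice gives \<open>h(X,Y) = - \<langle>X,Y\<rangle> e\<^sub>x\<close>, hence \<open>H = - e\<^sub>x\<close>, and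
  \<open>H = \<kappa>x - e\<^sub>x\<close> inside the hyperquadric. Both fields are affine in \<open>x\<close> with derivative a multiple
  of the identity, hence parallel; and \<open>\<langle>x,-H\<rangle> = \<langle>x,e\<^sub>x\<rangle> = 1\<close> is the canonical form at \<open>x\<close>.
  Finally \<open>\<psi>(p)\<^sup>2 = p\<^sub>0\<^sup>2\<close>, so \<open>\<psi>\<close> restricts to the hyperquadrics, and \<open>\<psi>\<close> has an explicit smooth
  inverse on an open set because \<open>\<rho>\<^sub>i\<^sup>2 = \<langle>a\<^sub>i,z\<rangle>\<^sup>2 + a\<^sub>i\<^sup>2 z\<^sub>i\<^sup>2\<close> for \<open>z = \<psi>(p)\<close> with
  \<open>V\<^sub>i\<close>-components \<open>z\<^sub>i\<close>.
\<close>

section \<open>Calculus of smooth maps\<close>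

text \<open>\<open>frechet_derivative\<close> is a choice among all derivatives at the point, so it
  suffices that two functions agreeing near \<open>x\<close> admit the same derivatives
  there.\<close>

lemma frechet_derivative_cong_open:
  assumes "open S" "x \<in> S" "\<And>y. y \<in> S \<Longrightarrow> f y = g y"
  shows "frechet_derivative f (at x) = frechet_derivative g (at x)"
    and "f differentiable (at x) \<longleftrightarrow> g differentiable (at x)"
proof -
  have *: "(f has_derivative D) (at x) \<longleftrightarrow> (g has_derivative D) (at x)" for D
    using has_derivative_transform_within_open[OF _ assms(1,2), of f D UNIV g]
      has_derivative_transform_within_open[OF _ assms(1,2), of g D UNIV f] assms(3) by auto
  show "frechet_derivative f (at x) = frechet_derivative g (at x)"
    by (simp add: frechet_derivative_def *)
  show "f differentiable (at x) \<longleftrightarrow> g differentiable (at x)"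
    by (simp add: differentiable_def *)
qed

lemma Ck_on_cong:
  assumes "open S" "\<And>x. x \<in> S \<Longrightarrow> f x = g x" "Ck_on k S f"
  shows "Ck_on k S g"
  using assms(2,3)
proof (induction k arbitrary: f g)
  case 0
  then show ?case using continuous_on_cong[of S S f g] by simp
next
  case (Suc k)
  note * = frechet_derivative_cong_open[OF assms(1) _ Suc.prems(1)]
  show ?case unfolding Ck_on.simps
  proof safe
    fix x assume "x \<in> S"
    with Suc.prems(2) *(2) show "g differentiable (at x)" by simp
  next
    fix v
    from Suc.prems(2) have "Ck_on k S (\<lambda>x. frechet_derivative f (at x) v)" by simp
    then show "Ck_on k S (\<lambda>x. frechet_derivative g (at x) v)"
      by (rule Suc.IH[rotated]) (simp only: *(1))
  qed
qed

text \<open>Replaces the chosen derivative by an explicit one, which uniqueness of derivatives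
  permits. Most closure proofs below go through this rule.\<close>

lemma Ck_on_SucI:
  assumes "open S" "\<And>x. x \<in> S \<Longrightarrow> (f has_derivative f' x) (at x)"
    and "\<And>v. Ck_on k S (\<lambda>x. f' x v)"
  shows "Ck_on (Suc k) S f"
  unfolding Ck_on.simps
proof safe
  fix x assume "x \<in> S"
  then show "f differentiable (at x)" using assms(2) differentiable_def by blast
next
  fix v show "Ck_on k S (\<lambda>x. frechet_derivative f (at x) v)"
    by (rule Ck_on_cong[OF assms(1) _ assms(3)[of v]])
      (simp only: frechet_derivative_at[OF assms(2), symmetric])
qed

lemma Ck_on_derivative:
  assumes "Ck_on (Suc k) S f" "x \<in> S"
  shows "(f has_derivative frechet_derivative f (at x)) (at x)"
proof -
  from assms have "f differentiable (at x)" by simp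
  then show ?thesis by (simp only: frechet_derivative_works)
qed

lemma Ck_on_lower: "Ck_on (Suc k) S f \<Longrightarrow> Ck_on k S f"
proof (induction k arbitrary: f)
  case 0
  then show ?case
    by (auto intro!: continuous_at_imp_continuous_on differentiable_imp_continuous_within)
next
  case (Suc k)
  from Suc.prems have "Ck_on k S (\<lambda>x. frechet_derivative f (at x) v)" for v
    using Suc.IH by (metis Ck_on.simps(2))
  with Suc.prems show ?case by simp
qed

lemma Ck_on_subset: "Ck_on k S f \<Longrightarrow> T \<subseteq> S \<Longrightarrow> Ck_on k T f"
  by (induction k arbitrary: f) (auto intro: continuous_on_subset)

lemma Ck_on_const: "Ck_on k S (\<lambda>x. c)"
proof (induction k arbitrary: c)
  case (Suc k) then show ?case by (simp add: frechet_derivative_const)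
qed simp

lemma Ck_on_add:
  assumes "open S" "Ck_on k S f" "Ck_on k S g"
  shows "Ck_on k S (\<lambda>x. f x + g x)"
  using assms(2,3)
proof (induction k arbitrary: f g)
  case 0 then show ?case by (auto intro: continuous_on_add)
next
  case (Suc k)
  show ?case
    by (rule Ck_on_SucI[OF assms(1) has_derivative_add[OF Suc.prems[THEN Ck_on_derivative]]])
      (use Suc in auto)
qed

lemma Ck_on_bounded_bilinear:
  assumes "bounded_bilinear h" "open S" "Ck_on k S f" "Ck_on k S g"
  shows "Ck_on k S (\<lambda>x. h (f x) (g x))"
  using assms(3,4)
proof (induction k arbitrary: f g)
  case 0 then show ?case using bounded_bilinear.continuous_on[OF assms(1)] by auto
next
  case (Suc k)
  have "Ck_on k S (\<lambda>x. frechet_derivative f (at x) v)" "Ck_on k S (\<lambda>x. frechet_derivative g (at x) v)" for v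
    using Suc.prems by auto
  then show ?case
    by (intro Ck_on_SucI[OF assms(2) bounded_bilinear.FDERIV[OF assms(1) Suc.prems[THEN Ck_on_derivative]]]
          Ck_on_add[OF assms(2)] Suc.IH Suc.prems[THEN Ck_on_lower]) auto
qed

lemma Ck_on_bounded_linear:
  assumes "bounded_linear h"
  shows "Ck_on k S h"
  using assms
  by (cases k) (auto intro: linear_continuous_on bounded_linear_imp_differentiable Ck_on_const
      simp: frechet_derivative_at[OF bounded_linear_imp_has_derivative[OF assms], symmetric])

lemma Ck_on_sum:
  assumes "open S" "\<And>i. i \<in> I \<Longrightarrow> Ck_on k S (f i)"
  shows "Ck_on k S (\<lambda>x. \<Sum>i\<in>I. f i x)"
  using assms(2) by (induction I rule: infinite_finite_induct) (auto intro: Ck_on_const Ck_on_add[OF assms(1)])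

lemma Ck_on_compose:
  fixes f :: "'a::euclidean_space \<Rightarrow> 'b::euclidean_space" and g :: "'b \<Rightarrow> 'c::euclidean_space"
  assumes "open S" "Ck_on k T g" "Ck_on k S f" "f ` S \<subseteq> T"
  shows "Ck_on k S (\<lambda>x. g (f x))"
  using assms(2,3)
proof (induction k arbitrary: g)
  case 0
  then show ?case using continuous_on_compose2 assms(4) by auto
next
  case (Suc k)
  let ?D = "\<lambda>x v. frechet_derivative g (at (f x)) (frechet_derivative f (at x) v)"
  have D: "((\<lambda>x. g (f x)) has_derivative ?D x) (at x)" if "x \<in> S" for x
    using has_derivative_compose[OF Ck_on_derivative[OF Suc.prems(2) that]
        Ck_on_derivative[OF Suc.prems(1)]] that assms(4) by auto
  \<comment> \<open>The induction hypothesis covers the derivative of \<open>g\<close> in a fixed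
    direction, while here the direction moves with \<open>x\<close>. Expanding it in the basis
    leaves fixed directions with scalar coefficients.\<close>
  have "Ck_on k S (\<lambda>x. ?D x v)" for v
  proof (rule Ck_on_cong[OF assms(1)])
    fix x assume "x \<in> S"
    then have l: "linear (frechet_derivative g (at (f x)))"
      using Ck_on_derivative[OF Suc.prems(1)] assms(4) has_derivative_linear by blast
    let ?y = "frechet_derivative f (at x) v"
    have "?D x v = frechet_derivative g (at (f x)) (\<Sum>b\<in>Basis. (?y \<bullet> b) *\<^sub>R b)"
      by (simp add: euclidean_representation)
    also have "\<dots> = (\<Sum>b\<in>Basis. (?y \<bullet> b) *\<^sub>R frechet_derivative g (at (f x)) b)"
      by (simp add: linear_sum[OF l] linear_scale[OF l])
    finally show "(\<Sum>b\<in>Basis. (?y \<bullet> b) *\<^sub>R frechet_derivative g (at (f x)) b) = ?D x v" by simp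
  next
    show "Ck_on k S (\<lambda>x. \<Sum>b\<in>Basis. (frechet_derivative f (at x) v \<bullet> b) *\<^sub>R frechet_derivative g (at (f x)) b)"
    proof (intro Ck_on_sum[OF assms(1)] Ck_on_bounded_bilinear[OF bounded_bilinear_scaleR assms(1)])
      fix b :: 'b
      show "Ck_on k S (\<lambda>x. frechet_derivative f (at x) v \<bullet> b)"
        using Suc.prems(2) by (intro Ck_on_bounded_bilinear[OF bounded_bilinear_inner assms(1)] Ck_on_const) auto
      show "Ck_on k S (\<lambda>x. frechet_derivative g (at (f x)) b)"
        by (rule Suc.IH) (use Suc.prems Ck_on_lower in auto)
    qed
  qed
  with D show ?case by (intro Ck_on_SucI[OF assms(1)])
qed

text \<open>The derivative is a polynomial in \<open>inverse\<close> itself, so the induction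
  closes; for \<open>sqrt\<close> below it is a multiple of the inverse of
  \<open>sqrt\<close>.\<close>

lemma Ck_on_inverse: "Ck_on k (- {0}) (inverse :: real \<Rightarrow> real)"
proof (induction k)
  case 0 show ?case by (auto intro!: continuous_intros)
next
  case (Suc k)
  have o: "open (- {0::real})" by auto
  have "Ck_on k (- {0}) (\<lambda>x::real. (- v) * (inverse x * inverse x))" for v
    by (intro Ck_on_bounded_bilinear[OF bounded_bilinear_mult o] Suc Ck_on_const)
  then show ?case
    by (rule Ck_on_SucI[OF o, rotated])
      (auto intro!: derivative_eq_intros simp: fun_eq_iff)
qed

lemma Ck_on_sqrt: "Ck_on k {0<..} sqrt"
proof (induction k)
  case 0 show ?case by (auto intro!: continuous_intros)
next
  case (Suc k)
  have o: "open {0::real<..}" by auto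
  have "Ck_on k {0<..} (\<lambda>x::real. (v / 2) * inverse (sqrt x))" for v
    by (intro Ck_on_bounded_bilinear[OF bounded_bilinear_mult o] Ck_on_const
        Ck_on_compose[OF o Ck_on_inverse Suc]) auto
  then show ?case
    by (rule Ck_on_SucI[OF o, rotated])
      (auto intro!: derivative_eq_intros simp: fun_eq_iff divide_simps)
qed

section \<open>Closure properties of smooth maps on open sets\<close>

lemma smooth_on_cong:
  assumes "open S" "\<And>x. x \<in> S \<Longrightarrow> f x = g x" "smooth_on S f"
  shows "smooth_on S g"
  using assms(3) Ck_on_cong[OF assms(1), of f g] assms(2) unfolding smooth_on_def by metis

lemma smooth_on_subset: "smooth_on S f \<Longrightarrow> T \<subseteq> S \<Longrightarrow> smooth_on T f"
  unfolding smooth_on_def by (blast intro: Ck_on_subset)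

lemma smooth_on_imp_continuous_on: "smooth_on S f \<Longrightarrow> continuous_on S f"
  unfolding smooth_on_def by (metis Ck_on.simps(1))

lemma smooth_on_derivative:
  "smooth_on S f \<Longrightarrow> x \<in> S \<Longrightarrow> (f has_derivative frechet_derivative f (at x)) (at x)"
  unfolding smooth_on_def using Ck_on_derivative by blast

lemma smooth_on_const: "smooth_on S (\<lambda>x. c)"
  by (simp add: smooth_on_def Ck_on_const)

lemma smooth_on_add: "open S \<Longrightarrow> smooth_on S f \<Longrightarrow> smooth_on S g \<Longrightarrow> smooth_on S (\<lambda>x. f x + g x)"
  unfolding smooth_on_def by (rule allI, rule Ck_on_add) auto

lemma smooth_on_sum:
  "open S \<Longrightarrow> (\<And>i. i \<in> I \<Longrightarrow> smooth_on S (f i)) \<Longrightarrow> smooth_on S (\<lambda>x. \<Sum>i\<in>I. f i x)"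
  unfolding smooth_on_def by (rule allI, rule Ck_on_sum) auto

lemma smooth_on_bounded_bilinear:
  "bounded_bilinear h \<Longrightarrow> open S \<Longrightarrow> smooth_on S f \<Longrightarrow> smooth_on S g \<Longrightarrow> smooth_on S (\<lambda>x. h (f x) (g x))"
  unfolding smooth_on_def by (rule allI, rule Ck_on_bounded_bilinear) auto

lemma smooth_on_compose:
  "open S \<Longrightarrow> smooth_on T g \<Longrightarrow> smooth_on S f \<Longrightarrow> f ` S \<subseteq> T \<Longrightarrow> smooth_on S (\<lambda>x. g (f x))"
  unfolding smooth_on_def by (rule allI, rule Ck_on_compose[where T = T]) auto

lemma smooth_on_linear:
  assumes "linear h" "open S" "smooth_on S f"
  shows "smooth_on S (\<lambda>x. h (f x))"
proof -
  have "smooth_on UNIV h"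
    using assms(1) by (simp add: smooth_on_def linear_conv_bounded_linear Ck_on_bounded_linear)
  from smooth_on_compose[OF assms(2) this assms(3)] show ?thesis by simp
qed

lemma smooth_on_id: "smooth_on S (\<lambda>x. x)"
  by (simp add: smooth_on_def Ck_on_bounded_linear bounded_linear_ident)

lemma smooth_on_inverse:
  "open S \<Longrightarrow> smooth_on S f \<Longrightarrow> (\<And>x. x \<in> S \<Longrightarrow> f x \<noteq> 0) \<Longrightarrow> smooth_on S (\<lambda>x. inverse (f x :: real))"
  by (rule smooth_on_compose[where T = "- {0}"]) (auto simp: smooth_on_def Ck_on_inverse)

lemma smooth_on_sqrt:
  "open S \<Longrightarrow> smooth_on S f \<Longrightarrow> (\<And>x. x \<in> S \<Longrightarrow> f x > 0) \<Longrightarrow> smooth_on S (\<lambda>x. sqrt (f x))"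
  by (rule smooth_on_compose[where T = "{0<..}"]) (auto simp: smooth_on_def Ck_on_sqrt)

lemma smooth_on_minus: "open S \<Longrightarrow> smooth_on S f \<Longrightarrow> smooth_on S (\<lambda>x. - f x)"
  by (rule smooth_on_linear[of uminus]) (simp_all add: linear_iff)

lemma smooth_on_diff: "open S \<Longrightarrow> smooth_on S f \<Longrightarrow> smooth_on S g \<Longrightarrow> smooth_on S (\<lambda>x. f x - g x)"
  using smooth_on_add[of S f "\<lambda>x. - g x"] smooth_on_minus[of S g] by simp

lemma smooth_on_divide:
  "open S \<Longrightarrow> smooth_on S f \<Longrightarrow> smooth_on S g \<Longrightarrow> (\<And>x. x \<in> S \<Longrightarrow> g x \<noteq> 0) \<Longrightarrow>
    smooth_on S (\<lambda>x. f x / g x :: real)"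
  unfolding divide_inverse
  by (rule smooth_on_bounded_bilinear[OF bounded_bilinear_mult]) (auto intro: smooth_on_inverse)

lemmas smooth_on_mult = smooth_on_bounded_bilinear[OF bounded_bilinear_mult]
lemmas smooth_on_scaleR = smooth_on_bounded_bilinear[OF bounded_bilinear_scaleR]

lemma smooth_on_vec:
  fixes f :: "'j::finite \<Rightarrow> 'a::euclidean_space \<Rightarrow> 'b::euclidean_space"
  assumes "open S" "\<And>j. smooth_on S (f j)"
  shows "smooth_on S (\<lambda>x. \<chi> j. f j x)"
proof -
  have "(\<lambda>x. \<chi> j. f j x) = (\<lambda>x. \<Sum>j\<in>UNIV. axis j (f j x))"
    by (auto simp: fun_eq_iff vec_eq_iff axis_def)
  moreover have "linear (axis j :: 'b \<Rightarrow> 'b ^ 'j)" for j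
    by (rule linearI) (auto simp: axis_def vec_eq_iff)
  moreover have "smooth_on S (\<lambda>x. \<Sum>j\<in>UNIV. axis j (f j x))" if "\<And>j. linear (axis j :: 'b \<Rightarrow> 'b ^ 'j)"
    by (rule smooth_on_sum[OF assms(1)]) (rule smooth_on_linear[OF that assms])
  ultimately show ?thesis by simp
qed

lemma linear_vec_nth: "linear (\<lambda>x. x $ j)"
  by (rule linearI) auto

section \<open>Tangent vectors and differentials\<close>

text \<open>\<open>tangent_space\<close> asks for a symmetric interval mapped into \<open>M\<close>.
  A curve on any open parameter set will do, with membership checked only while it stays in a
  neighbourhood \<open>O'\<close> of \<open>p\<close>: continuity supplies the interval.\<close>

lemma tangent_spaceI:
  assumes "open T" "0 \<in> T" "smooth_on T \<gamma>" "open O'" "\<And>t. t \<in> T \<Longrightarrow> \<gamma> t \<in> O' \<Longrightarrow> \<gamma> t \<in> M"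
    and "\<gamma> (0::real) = p" "p \<in> O'" "(\<gamma> has_vector_derivative v) (at 0)"
  shows "v \<in> tangent_space M p"
proof -
  have "open (T \<inter> \<gamma> -` O')"
    using continuous_on_open_vimage[OF assms(1)] smooth_on_imp_continuous_on[OF assms(3)] assms(4)
    by (metis Int_commute)
  moreover have "0 \<in> T \<inter> \<gamma> -` O'" using assms by auto
  ultimately obtain e where e: "e > 0" "ball 0 e \<subseteq> T \<inter> \<gamma> -` O'" by (meson openE)
  have "ball (0::real) e = {-e<..<e}" by (auto simp: dist_real_def)
  with e have "{-e<..<e} \<subseteq> T" "\<gamma> ` {-e<..<e} \<subseteq> M" using assms(5) by auto
  then show ?thesis
    unfolding tangent_space_def using e(1) assms(6,8) smooth_on_subset[OF assms(3)] by blast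
qed

lemma derivative_along_curve:
  assumes "smooth_on U F" "open U" "p \<in> U" "\<gamma> 0 = p" "(\<gamma> has_vector_derivative v) (at 0)"
  shows "((\<lambda>t. F (\<gamma> t)) has_vector_derivative frechet_derivative F (at p) v) (at 0)"
proof -
  have "(F has_derivative frechet_derivative F (at p)) (at (\<gamma> 0) within UNIV)"
    using smooth_on_derivative[OF assms(1,3)] assms(4) by simp
  from has_derivative_compose[OF assms(5)[unfolded has_vector_derivative_def] this[simplified]]
  show ?thesis
    using linear_scale[OF has_derivative_linear[OF smooth_on_derivative[OF assms(1,3)]]]
    by (simp add: has_vector_derivative_def)
qed

lemma curve_eventually:
  fixes \<gamma> :: "real \<Rightarrow> 'a::euclidean_space"
  assumes "open U" "\<gamma> 0 \<in> U" "(\<gamma> has_vector_derivative v) (at 0)"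
  shows "\<forall>\<^sub>F t in nhds 0. \<gamma> t \<in> U"
proof -
  have "isCont \<gamma> 0" using assms(3) has_vector_derivative_continuous by blast
  then have "filterlim \<gamma> (nhds (\<gamma> 0)) (nhds 0)" by (simp add: isCont_def tendsto_nhds_iff)
  then show ?thesis using assms(1,2) by (rule topological_tendstoD)
qed

lemma tangent_curve:
  assumes "v \<in> tangent_space M p" "open U" "p \<in> U"
  obtains \<gamma> where "\<gamma> (0::real) = p" "(\<gamma> has_vector_derivative v) (at 0)"
    "\<forall>\<^sub>F t in nhds 0. \<gamma> t \<in> M \<inter> U"
proof -
  obtain \<gamma> and e :: real where g: "e > 0" "\<gamma> ` {-e<..<e} \<subseteq> M" "\<gamma> 0 = p"
      "(\<gamma> has_vector_derivative v) (at 0)"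
    using assms(1) unfolding tangent_space_def by auto
  have "\<forall>\<^sub>F t in nhds 0. t \<in> {-e<..<e}"
    using g(1) by (intro eventually_nhds_in_open) auto
  moreover have "\<forall>\<^sub>F t in nhds 0. \<gamma> t \<in> U"
    using curve_eventually[OF assms(2) _ g(4)] g(3) assms(3) by auto
  ultimately have "\<forall>\<^sub>F t in nhds 0. \<gamma> t \<in> M \<inter> U"
    by eventually_elim (use g(2) in auto)
  with g that show ?thesis by blast
qed

text \<open>The means by which equations that hold along a curve in a submanifold are
  differentiated: each side is given its own derivative.\<close>

lemma has_vector_derivative_eventually_unique:
  assumes "(f has_vector_derivative v) (at (0::real))" "(g has_vector_derivative w) (at 0)"
    "\<forall>\<^sub>F t in nhds 0. f t = g t"
  shows "v = w"
proof -
  obtain S where "open S" "0 \<in> S" "\<And>t. t \<in> S \<Longrightarrow> f t = g t"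
    using assms(3) unfolding eventually_nhds by auto
  then have "(g has_vector_derivative v) (at 0)"
    using has_vector_derivative_transform_within_open[OF assms(1)] by blast
  from vector_derivative_unique_at[OF this assms(2)] show ?thesis .
qed

text \<open>Two local extensions both equal \<open>f\<close> along a curve in \<open>P\<close> with
  velocity \<open>X\<close>, so their derivatives in that direction agree. The choice in
  \<open>differential\<close> can thus be replaced by any known extension.\<close>

lemma differential_eq:
  assumes F: "local_extension P f x F" and X: "X \<in> tangent_space P x"
  shows "differential P f x X = frechet_derivative F (at x) X"
proof -
  define G where "G = (SOME F. local_extension P f x F)"
  have G: "local_extension P f x G" unfolding G_def by (rule someI[of "local_extension P f x", OF F])
  from F G obtain U U' where U: "open U" "x \<in> U" "smooth_on U F" "\<forall>y\<in>P \<inter> U. F y = f y"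
      and U': "open U'" "x \<in> U'" "smooth_on U' G" "\<forall>y\<in>P \<inter> U'. G y = f y"
    unfolding local_extension_def by auto
  obtain \<gamma> where \<gamma>: "\<gamma> (0::real) = x" "(\<gamma> has_vector_derivative X) (at 0)"
      "\<forall>\<^sub>F t in nhds 0. \<gamma> t \<in> P \<inter> (U \<inter> U')"
    using tangent_curve[OF X, of "U \<inter> U'"] U(1,2) U'(1,2) by auto
  have "frechet_derivative G (at x) X = frechet_derivative F (at x) X"
    by (rule has_vector_derivative_eventually_unique
        [OF derivative_along_curve[OF U'(3,1,2) \<gamma>(1,2)] derivative_along_curve[OF U(3,1,2) \<gamma>(1,2)]])
      (use \<gamma>(3) U(4) U'(4) in \<open>auto elim!: eventually_mono\<close>)
  then show ?thesis by (simp add: differential_def G_def)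
qed

lemma smooth_mapI:
  assumes "open U" "smooth_on U F" "P \<subseteq> U" "\<And>y. y \<in> P \<Longrightarrow> F y = f y"
  shows "smooth_map P f"
  unfolding smooth_map_def local_extension_def using assms by blast

text \<open>A subspace is its own double orthogonal complement, so \<open>v\<close> is tested
  against vectors of the complement; the Euclidean inner product serves as a tool for this
  test.\<close>

lemma vector_derivative_in_subspace:
  fixes \<gamma> :: "real \<Rightarrow> 'a::euclidean_space"
  assumes "subspace W" "(\<gamma> has_vector_derivative v) (at 0)" "\<forall>\<^sub>F t in nhds 0. \<gamma> t - p \<in> W"
  shows "v \<in> W"
proof -
  have "v \<bullet> z = 0" if z: "z \<in> orthogonal_comp W" for z
  proof (rule has_vector_derivative_eventually_unique)
    show "((\<lambda>t. (\<gamma> t - p) \<bullet> z) has_vector_derivative v \<bullet> z) (at 0)"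
      using assms(2) by (auto intro!: derivative_eq_intros
          bounded_linear.has_vector_derivative[OF bounded_linear_inner_left])
    show "((\<lambda>t::real. 0::real) has_vector_derivative 0) (at 0)" by simp
    show "\<forall>\<^sub>F t in nhds 0. (\<gamma> t - p) \<bullet> z = 0"
      using assms(3) by eventually_elim (use z in \<open>auto simp: orthogonal_comp_def orthogonal_def inner_commute\<close>)
  qed
  then have "v \<in> orthogonal_comp (orthogonal_comp W)"
    by (auto simp: orthogonal_comp_def orthogonal_def inner_commute)
  then show ?thesis using orthogonal_comp_self[OF assms(1)] by simp
qed

lemma tangent_space_UNIV: "tangent_space (UNIV :: 'a::euclidean_space set) p = UNIV"
proof -
  have "v \<in> tangent_space UNIV p" for v :: 'a
  proof (rule tangent_spaceI[where T = UNIV and O' = UNIV])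
    show "smooth_on UNIV (\<lambda>t::real. p + t *\<^sub>R v)"
      by (intro smooth_on_add smooth_on_scaleR smooth_on_const smooth_on_id open_UNIV)
    show "((\<lambda>t. p + t *\<^sub>R v) has_vector_derivative v) (at 0)"
      by (auto intro!: derivative_eq_intros)
  qed auto
  then show ?thesis by auto
qed

lemma submanifold_UNIV: "submanifold DIM('a) (UNIV :: 'a::euclidean_space set)"
proof -
  have "slice_chart DIM('a) UNIV UNIV (\<lambda>x::'a. x)"
    unfolding slice_chart_def
    using smooth_on_cong[OF open_UNIV _ smooth_on_id[of UNIV], of "inv_into UNIV (\<lambda>x::'a. x)"]
    by (auto simp: smooth_on_id inv_into_f_f inj_on_def intro!: exI[of _ UNIV])
  then show ?thesis unfolding submanifold_def by blast
qed

section \<open>Scalar products\<close>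

locale scalar_product =
  fixes B :: "'a::euclidean_space \<Rightarrow> 'a \<Rightarrow> real"
  assumes bilin: "bilinear B" and B_sym: "B x y = B y x" and nondeg: "nondegenerate_on B UNIV"
begin

lemmas B_add = bilinear_ladd[OF bilin] bilinear_radd[OF bilin]
lemmas B_diff = bilinear_lsub[OF bilin] bilinear_rsub[OF bilin]
lemmas B_scale = bilinear_lmul[OF bilin] bilinear_rmul[OF bilin]
lemmas B_zero = bilinear_lzero[OF bilin] bilinear_rzero[OF bilin]
lemmas B_minus = bilinear_lneg[OF bilin] bilinear_rneg[OF bilin]
lemmas B_simps = B_add B_diff B_scale B_zero B_minus

lemma B_sum: "B (\<Sum>i\<in>I. f i) y = (\<Sum>i\<in>I. B (f i) y)" "B x (\<Sum>i\<in>I. f i) = (\<Sum>i\<in>I. B x (f i))"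
  by (induction I rule: infinite_finite_induct) (simp_all add: B_simps)

lemma bounded_bilinear_B: "bounded_bilinear B"
  using bilin bilinear_conv_bounded_bilinear by blast

lemmas smooth_on_B = smooth_on_bounded_bilinear[OF bounded_bilinear_B]

lemma has_vector_derivative_B:
  assumes "(f has_vector_derivative f') (at t)" "(g has_vector_derivative g') (at t)"
  shows "((\<lambda>t. B (f t) (g t)) has_vector_derivative B (f t) g' + B f' (g t)) (at t)"
  by (rule bounded_bilinear.has_vector_derivative[OF bounded_bilinear_B assms])

lemma nondegD: "(\<And>y. B x y = 0) \<Longrightarrow> x = 0"
  using nondeg unfolding nondegenerate_on_def by blast

text \<open>Polarization: a symmetric form that vanishes on the diagonal of \<open>T\<close>
  vanishes on all of \<open>T\<close>.\<close>

lemma ex_nonnull: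
  assumes "subspace T" "nondegenerate_on B T" "T \<noteq> {0}"
  shows "\<exists>v\<in>T. B v v \<noteq> 0"
proof (rule ccontr)
  assume *: "\<not> ?thesis"
  have "B x y = 0" if "x \<in> T" "y \<in> T" for x y
  proof -
    have "x + y \<in> T" using that assms(1) subspace_add by blast
    with * that have "B (x + y) (x + y) = 0" "B x x = 0" "B y y = 0" by auto
    then show ?thesis using B_sym[of y x] by (simp add: B_simps)
  qed
  with assms(2) have "\<forall>x\<in>T. x = 0" unfolding nondegenerate_on_def by blast
  with assms(1,3) show False using subspace_0 by blast
qed

lemma subspace_perp: "subspace {t. B v t = 0}"
  by (auto simp: subspace_def B_simps)

lemma subspace_orth: "subspace (orth B S)"
  by (auto simp: subspace_def B_simps orth_def)

text \<open>\<open>W\<close> is the kernel of the functional \<open>B v\<close> on \<open>W\<close>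
  plus the line of \<open>w\<close>. The vector \<open>v\<close> may lie outside \<open>W\<close>;
  later it is also the base point of a slice.\<close>

lemma dim_perp_within:
  assumes "subspace W" "w \<in> W" "B v w \<noteq> 0"
  shows "dim W = Suc (dim {t \<in> W. B v t = 0})"
proof -
  let ?S = "{t \<in> W. B v t = 0}"
  have S: "subspace ?S"
    using subspace_inter[OF assms(1) subspace_perp[of v]] by (simp add: Int_def)
  have "span (insert w ?S) = W"
  proof
    show "span (insert w ?S) \<subseteq> W" using assms(1,2) by (intro span_minimal) auto
    show "W \<subseteq> span (insert w ?S)"
    proof
      fix x assume x: "x \<in> W"
      let ?t = "x - (B v x / B v w) *\<^sub>R w"
      have "?t \<in> ?S" using x assms by (auto simp: B_simps intro: subspace_diff subspace_scale)
      then have "?t + (B v x / B v w) *\<^sub>R w \<in> span (insert w ?S)"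
        by (intro span_add span_scale span_base) auto
      then show "x \<in> span (insert w ?S)" by simp
    qed
  qed
  moreover have "w \<notin> span ?S" using S assms by (simp add: span_eq_iff[THEN iffD2])
  ultimately show ?thesis by (metis dim_insert dim_span Suc_eq_plus1)
qed

text \<open>Gram-Schmidt for an indefinite form: split off a non-null vector scaled to square 1 or
  -1; its complement within \<open>T\<close> is again non-degenerate.\<close>

lemma ex_orthonormal_basis:
  assumes "subspace T" "nondegenerate_on B T"
  shows "\<exists>b. orthonormal_basis_of B T b"
  using assms
proof (induction "dim T" arbitrary: T)
  case 0
  then have "T = {0}" using subspace_0[OF 0(2)] dim_eq_0[of T] by auto
  then show ?case by (intro exI[of _ "{}"]) (auto simp: orthonormal_basis_of_def independent_empty)
next
  case (Suc n)
  then have "T \<noteq> {0}" by auto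
  with Suc.prems obtain v0 where v0: "v0 \<in> T" "B v0 v0 \<noteq> 0" using ex_nonnull by blast
  define v where "v = (1 / sqrt \<bar>B v0 v0\<bar>) *\<^sub>R v0"
  have v: "v \<in> T" "\<bar>B v v\<bar> = 1"
    using v0 Suc.prems(1) by (auto simp: v_def B_simps abs_mult subspace_scale)
  then have vv: "B v v \<noteq> 0" by auto
  let ?T = "{t \<in> T. B v t = 0}"
  have split: "x - (B v x / B v v) *\<^sub>R v \<in> ?T" if "x \<in> T" for x
    using that v vv Suc.prems(1) by (auto simp: B_simps intro: subspace_diff subspace_scale)
  have sT: "subspace ?T"
    using subspace_inter[OF Suc.prems(1) subspace_perp[of v]] by (simp add: Int_def)
  have "nondegenerate_on B ?T" unfolding nondegenerate_on_def
  proof safe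
    fix x assume x: "x \<in> T" "B v x = 0" "\<forall>y\<in>?T. B x y = 0"
    have "B x y = 0" if "y \<in> T" for y
      using x(3)[rule_format, OF split[OF that]] x(2) B_sym[of v x] by (simp add: B_simps)
    then show "x = 0" using x(1) Suc.prems(2) unfolding nondegenerate_on_def by blast
  qed
  moreover have "n = dim ?T" using dim_perp_within[OF Suc.prems(1) v(1) vv] Suc.hyps(2) by simp
  ultimately obtain b where b: "orthonormal_basis_of B ?T b" using Suc.hyps(1)[OF _ sT] by auto
  have sb: "span b = ?T" and bT: "b \<subseteq> ?T" using b by (auto simp: orthonormal_basis_of_def)
  have "span (insert v b) = T"
  proof
    show "span (insert v b) \<subseteq> T" using Suc.prems(1) v(1) bT by (intro span_minimal) auto
    show "T \<subseteq> span (insert v b)"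
    proof
      fix x assume "x \<in> T"
      from split[OF this] have "x - (B v x / B v v) *\<^sub>R v \<in> span b" using sb by simp
      then have "(x - (B v x / B v v) *\<^sub>R v) + (B v x / B v v) *\<^sub>R v \<in> span (insert v b)"
        using span_mono[of b "insert v b"] by (intro span_add span_scale) (auto intro: span_base)
      then show "x \<in> span (insert v b)" by simp
    qed
  qed
  moreover have "independent (insert v b)"
    using b sb vv by (auto simp: orthonormal_basis_of_def independent_insert)
  moreover have "\<forall>e\<in>b. B v e = 0" using bT by blast
  then have "\<forall>e\<in>b. B v e = 0 \<and> B e v = 0" using B_sym by metis
  moreover have "insert v b \<subseteq> T" using bT v(1) by blast
  moreover have "\<forall>e\<in>b. \<bar>B e e\<bar> = 1" "\<forall>e\<in>b. \<forall>f\<in>b. e \<noteq> f \<longrightarrow> B e f = 0"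
    using b unfolding orthonormal_basis_of_def by blast+
  ultimately have "orthonormal_basis_of B T (insert v b)"
    using v(2) unfolding orthonormal_basis_of_def by simp
  then show ?case by blast
qed

lemma orthonormal_basis_SOME:
  assumes "subspace T" "nondegenerate_on B T"
  shows "orthonormal_basis_of B T (SOME b. orthonormal_basis_of B T b)"
  using ex_orthonormal_basis[OF assms] by (rule someI_ex)

lemma orth_decomposition:
  assumes "subspace T" "nondegenerate_on B T"
  obtains t where "t \<in> T" "v - t \<in> orth B T"
proof -
  obtain b where b: "orthonormal_basis_of B T b" using ex_orthonormal_basis[OF assms] by blast
  then have fin: "finite b" using independent_imp_finite by (auto simp: orthonormal_basis_of_def)
  \<comment> \<open>The factor \<open>B e e\<close> is the sign of the basis vector, which is its
    own inverse.\<close>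
  define t where "t = (\<Sum>e\<in>b. (B e e * B v e) *\<^sub>R e)"
  have sb: "span b = T" using b by (simp add: orthonormal_basis_of_def)
  have "B (v - t) e = 0" if e: "e \<in> b" for e
  proof -
    have "B t e = (\<Sum>f\<in>b. B f f * B v f * B f e)" by (simp add: t_def B_sum B_simps)
    also have "\<dots> = (\<Sum>f\<in>b. if f = e then B e e * B v e * B e e else 0)"
      using b e by (intro sum.cong) (auto simp: orthonormal_basis_of_def)
    also have "\<dots> = B v e * (B e e * B e e)" using fin e by simp
    also have "B e e * B e e = 1"
      using b e abs_mult_self_eq[of "B e e"] by (simp add: orthonormal_basis_of_def)
    finally show ?thesis by (simp add: B_simps)
  qed
  then have "b \<subseteq> {t'. B (v - t) t' = 0}" by blast
  then have "T \<subseteq> {t'. B (v - t) t' = 0}" using span_minimal[OF _ subspace_perp] sb by blast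
  then have "v - t \<in> orth B T" by (auto simp: orth_def)
  moreover have "t \<in> T" unfolding t_def sb[symmetric] by (intro span_sum span_scale span_base)
  ultimately show ?thesis using that by blast
qed

lemma orth_projI:
  assumes "subspace S" "nondegenerate_on B S" "w \<in> S" "v - w \<in> orth B S"
  shows "orth_proj B S v = w"
  unfolding orth_proj_def
proof (rule the_equality)
  fix w' assume w': "w' \<in> S \<and> v - w' \<in> orth B S"
  then have "w' - w \<in> S" using assms by (auto intro: subspace_diff)
  moreover have "B (w' - w) y = 0" if "y \<in> S" for y
  proof -
    have "B (v - w) y = 0" "B (v - w') y = 0" using that w' assms(4) by (auto simp: orth_def)
    then show ?thesis by (simp add: B_simps)
  qed
  ultimately show "w' = w" using assms(2) unfolding nondegenerate_on_def by auto
qed (use assms in auto)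

section \<open>Slices of quadrics\<close>

definition slice :: "'a \<Rightarrow> 'a set \<Rightarrow> 'a set" where
  "slice p W = {x. x - p \<in> W \<and> B x x = B p p}"

text \<open>For \<open>dim W \<ge> 2\<close> such an \<open>e\<close> turns out to be minus the mean
  curvature vector of \<open>slice p W\<close> at \<open>p\<close> in the flat space.
  \<open>B\<close> may be degenerate on \<open>W\<close>, as happens for lightlike
  \<open>a i\<close>. The last clause excludes a null line and supplies the direction from which
  charts are built.\<close>

definition pole :: "'a set \<Rightarrow> 'a \<Rightarrow> 'a \<Rightarrow> bool" where
  "pole W p e \<longleftrightarrow> subspace W \<and> e \<in> W \<and> B p e = 1 \<and> (\<forall>t\<in>W. B p t = 0 \<longrightarrow> B e t = 0) \<and>
     nondegenerate_on B {t \<in> W. B p t = 0} \<and> (\<exists>w\<in>W. B w w \<noteq> 0)"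

lemma poleD:
  assumes "pole W p e"
  shows "subspace W" "e \<in> W" "B p e = 1" "\<And>t. t \<in> W \<Longrightarrow> B p t = 0 \<Longrightarrow> B e t = 0"
    "nondegenerate_on B {t \<in> W. B p t = 0}"
  using assms by (auto simp: pole_def)

text \<open>\<open>W\<close> is the line of \<open>e\<close> plus the tangent vectors, which
  \<open>B p\<close> kills and to which \<open>e\<close> is orthogonal; only the coefficient
  \<open>B p w\<close> of \<open>e\<close> counts.\<close>

lemma pole_product:
  assumes "pole W p e" "w \<in> W"
  shows "B e w = B e e * B p w"
proof -
  have "w - B p w *\<^sub>R e \<in> W" using poleD[OF assms(1)] assms(2) by (auto intro: subspace_diff subspace_scale)
  moreover have "B p (w - B p w *\<^sub>R e) = 0" using poleD(3)[OF assms(1)] by (simp add: B_simps)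
  ultimately have "B e (w - B p w *\<^sub>R e) = 0" by (rule poleD(4)[OF assms(1)])
  then show ?thesis by (simp add: B_simps)
qed

lemma slice_self: "subspace W \<Longrightarrow> p \<in> slice p W"
  by (simp add: slice_def subspace_0)

lemma slice_eq:
  assumes "subspace W" "x \<in> slice p W"
  shows "slice x W = slice p W"
proof -
  have *: "x - p \<in> W" "B x x = B p p" using assms(2) by (auto simp: slice_def)
  have "y - x \<in> W \<longleftrightarrow> y - p \<in> W" for y
    using subspace_diff[OF assms(1) _ *(1), of "y - p"] subspace_add[OF assms(1) _ *(1), of "y - x"] by auto
  with * show ?thesis by (auto simp: slice_def)
qed

lemma slice_chord: "x \<in> slice p W \<Longrightarrow> B (x - p) (x - p) = - 2 * B p (x - p)"
  using B_sym[of x p] by (simp add: slice_def B_simps)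

text \<open>By \<open>pole_product\<close> the new vector pairs with \<open>w \<in> W\<close> to
  \<open>B e e * B x w\<close>, hence is orthogonal to the tangent vectors at \<open>x\<close>. A
  vector in the radical of the tangent space at \<open>x\<close> is orthogonal to all of
  \<open>W\<close>, in particular to \<open>x - p\<close>; so it is tangent at \<open>p\<close> and
  lies in the radical there.\<close>

lemma pole_transfer:
  assumes e: "pole W p e" and x: "x \<in> slice p W"
  shows "pole W x (e + B e e *\<^sub>R (x - p))"
    and "B (e + B e e *\<^sub>R (x - p)) (e + B e e *\<^sub>R (x - p)) = B e e"
proof -
  note W = poleD[OF e]
  have xp: "x - p \<in> W" "B x x = B p p" using x by (auto simp: slice_def)
  let ?e = "e + B e e *\<^sub>R (x - p)"
  have eW: "?e \<in> W" using W xp by (auto intro: subspace_add subspace_scale)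
  have prod: "B ?e w = B e e * B x w" if "w \<in> W" for w
    using pole_product[OF e that] by (simp add: B_simps algebra_simps)
  have one: "B x ?e = 1"
    using pole_product[OF e xp(1)] W(3) xp(2) B_sym[of x p] B_sym[of e x] B_sym[of e p]
    by (simp add: B_simps algebra_simps)
  show "B ?e ?e = B e e" using prod[OF eW] one by simp
  have "nondegenerate_on B {t \<in> W. B x t = 0}" unfolding nondegenerate_on_def
  proof safe
    fix u assume u: "u \<in> W" "B x u = 0" "\<forall>y\<in>{t \<in> W. B x t = 0}. B u y = 0"
    have rad: "B u w = 0" if w: "w \<in> W" for w
    proof -
      have "w - B x w *\<^sub>R ?e \<in> {t \<in> W. B x t = 0}"
        using w eW W(1) one by (auto intro: subspace_diff subspace_scale simp: B_scale B_diff)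
      then have "B u (w - B x w *\<^sub>R ?e) = 0" using u(3) by blast
      moreover have "B u ?e = 0" using prod[OF u(1)] u(2) B_sym[of u ?e] by simp
      ultimately show ?thesis by (simp add: B_diff B_scale)
    qed
    have "B p u = 0" using rad[OF xp(1)] u(2) B_sym[of u x] B_sym[of u p] by (simp add: B_simps)
    with rad u(1) W(5) show "u = 0" unfolding nondegenerate_on_def by blast
  qed
  with e eW one prod show "pole W x ?e" by (auto simp: pole_def)
qed

text \<open>If \<open>B p w0 \<noteq> 0\<close>, a sign change suffices. If \<open>w0\<close> is
  tangent, \<open>e\<close> serves when it is non-null, and otherwise \<open>e + w0\<close>, whose
  square is that of \<open>w0\<close> because \<open>e\<close> is null and orthogonal to
  \<open>w0\<close>.\<close>

lemma pole_nonnull: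
  assumes "pole W p e"
  obtains w where "w \<in> W" "B p w > 0" "B w w \<noteq> 0"
proof -
  note W = poleD[OF assms]
  obtain w0 where w0: "w0 \<in> W" "B w0 w0 \<noteq> 0" using assms by (auto simp: pole_def)
  consider "B p w0 > 0" | "B p w0 < 0" | "B p w0 = 0" "B e e \<noteq> 0" | "B p w0 = 0" "B e e = 0" by linarith
  then show ?thesis
  proof cases
    case 1 then show ?thesis using that w0 by blast
  next
    case 2 then show ?thesis using that[of "- w0"] w0 W(1) by (simp add: B_minus subspace_neg)
  next
    case 3 then show ?thesis using that[of e] W by simp
  next
    case 4
    have "B e w0 = 0" "B w0 e = 0" using W(4)[OF w0(1)] 4 B_sym[of w0 e] by auto
    then show ?thesis using that[of "e + w0"] W(1-3) w0 4 by (simp add: B_add subspace_add)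
  qed
qed

text \<open>
  With \<open>n\<close> the projection along a non-null \<open>w \<in> W\<close>, the point \<open>x\<close> is recovered from \<open>n x\<close> and \<open>x\<^sup>2\<close>,
  since \<open>w\<^sup>2 x\<^sup>2 = w\<^sup>2 (n x)\<^sup>2 + \<langle>x,w\<rangle>\<^sup>2\<close> determines \<open>\<langle>x,w\<rangle> > 0\<close>.
\<close>

lemma slice_chart_slice:
  assumes e: "pole W p e" and O: "open O'" "p \<in> O'"
  obtains U \<Phi> where "p \<in> U" "slice_chart (dim W - 1) (slice p W \<inter> O') U \<Phi>"
proof -
  note W = poleD[OF e]
  obtain w where w: "w \<in> W" "B p w > 0" "B w w \<noteq> 0" using pole_nonnull[OF e] by blast
  define n where "n x = x - (B x w / B w w) *\<^sub>R w" for x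
  \<comment> \<open>Placing \<open>B x x - B p p\<close> along \<open>w\<close> turns the quadric
    equation into the linear condition that this coordinate vanishes.\<close>
  define \<Phi> where "\<Phi> x = n x - n p + (B x x - B p p) *\<^sub>R w" for x
  \<comment> \<open>The value of \<open>(B x w)^2\<close> computed from \<open>y = \<Phi> x\<close>;
    on \<open>U\<close> the positive root is the right one.\<close>
  define R where "R y = B y w + B w w * (B p p - B (n y + n p) (n y + n p))" for y
  define \<Psi> where "\<Psi> y = n y + n p + (sqrt (R y) / B w w) *\<^sub>R w" for y
  define U where "U = O' \<inter> {x. B x w > 0}"
  have nw: "B (n x) w = 0" "B w (n x) = 0" "n (n x) = n x" "n w = 0" for x
    using w(3) B_sym[of w x] by (auto simp: n_def B_simps)
  have nlin: "n (x + y) = n x + n y" "n (x - y) = n x - n y" "n (r *\<^sub>R x) = r *\<^sub>R n x" for x y r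
    by (auto simp: n_def B_simps algebra_simps add_divide_distrib diff_divide_distrib)
  have split: "x = n x + (B x w / B w w) *\<^sub>R w" for x by (simp add: n_def)
  have sq: "B w w * B x x = B w w * B (n x) (n x) + (B x w)\<^sup>2" for x
  proof -
    have "B x x = B (n x + (B x w / B w w) *\<^sub>R w) (n x + (B x w / B w w) *\<^sub>R w)"
      using split[of x] by simp
    then show ?thesis using w(3) by (simp add: B_add B_scale nw power2_eq_square field_simps)
  qed
  have n\<Phi>: "n (\<Phi> x) = n x - n p" "B (\<Phi> x) w = (B x x - B p p) * B w w" for x
    by (auto simp: \<Phi>_def nlin nw B_add B_diff B_scale)
  have R\<Phi>: "R (\<Phi> x) = (B x w)\<^sup>2" for x
    using sq[of x] by (simp add: R_def n\<Phi> algebra_simps)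
  have \<Psi>\<Phi>: "\<Psi> (\<Phi> x) = x" if "B x w > 0" for x
    using split[of x] that by (simp add: \<Psi>_def R\<Phi> n\<Phi>)
  have n\<Psi>: "n (\<Psi> y) = n y + n p" "B (\<Psi> y) w = sqrt (R y)" for y
    using w(3) by (auto simp: \<Psi>_def nlin nw B_add B_scale)
  have \<Phi>\<Psi>: "\<Phi> (\<Psi> y) = y" if "R y > 0" for y
  proof -
    have "B w w * B (\<Psi> y) (\<Psi> y) = B y w + B w w * B p p"
      using sq[of "\<Psi> y"] that by (simp add: n\<Psi>) (simp add: R_def algebra_simps)
    then have "B (\<Psi> y) (\<Psi> y) = B y w / B w w + B p p" using w(3) by (simp add: field_simps)
    then show ?thesis using split[of y] by (simp add: \<Phi>_def n\<Psi>)
  qed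
  let ?D = "{y. R y > 0}"
  \<comment> \<open>Describing the image as a preimage under the continuous map
    \<open>\<Psi>\<close> is what shows it to be open.\<close>
  have im: "\<Phi> ` U = ?D \<inter> \<Psi> -` O'"
  proof (intro equalityI image_subsetI subsetI)
    fix x assume "x \<in> U"
    then show "\<Phi> x \<in> ?D \<inter> \<Psi> -` O'" by (auto simp: U_def R\<Phi> \<Psi>\<Phi>)
  next
    fix y assume "y \<in> ?D \<inter> \<Psi> -` O'"
    then have y: "R y > 0" "\<Psi> y \<in> O'" by auto
    then have "\<Psi> y \<in> U" by (simp add: U_def n\<Psi>)
    then show "y \<in> \<Phi> ` U" using \<Phi>\<Psi>[OF y(1)] by (metis imageI)
  qed
  have sn: "smooth_on S n" if "open S" for S
    unfolding n_def divide_inverse using that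
    by (intro smooth_on_diff smooth_on_scaleR smooth_on_mult smooth_on_B smooth_on_const smooth_on_id)
  have sB: "smooth_on S (\<lambda>x. B x w)" if "open S" for S
    using that by (intro smooth_on_B smooth_on_const smooth_on_id)
  have s\<Phi>: "smooth_on S \<Phi>" if "open S" for S
    unfolding \<Phi>_def using that
    by (intro smooth_on_diff smooth_on_add smooth_on_scaleR smooth_on_B smooth_on_const smooth_on_id sn)
  have sR: "smooth_on S R" if "open S" for S
    unfolding R_def using that
    by (intro smooth_on_diff smooth_on_add smooth_on_mult smooth_on_B smooth_on_const smooth_on_id sn)
  have "continuous_on UNIV (\<lambda>x. B x w)" using smooth_on_imp_continuous_on[OF sB[OF open_UNIV]] .
  from continuous_on_open_vimage[OF open_UNIV, THEN iffD1, OF this, rule_format, of "{0<..}"]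
  have oU: "open U" using O(1) by (auto simp: U_def vimage_def intro: open_Int)
  from continuous_on_open_vimage[OF open_UNIV, THEN iffD1, OF smooth_on_imp_continuous_on[OF sR[OF open_UNIV]],
      rule_format, of "{0<..}"]
  have oD: "open ?D" by (simp add: vimage_def)
  have s\<Psi>: "smooth_on ?D \<Psi>"
    unfolding \<Psi>_def divide_inverse using oD
    by (intro smooth_on_add smooth_on_scaleR smooth_on_mult smooth_on_const sn smooth_on_sqrt sR) auto
  have oim: "open (\<Phi> ` U)"
    unfolding im using continuous_on_open_vimage[OF oD, THEN iffD1, OF smooth_on_imp_continuous_on[OF s\<Psi>], rule_format, OF O(1)]
    by (simp add: Int_commute)
  have inj: "inj_on \<Phi> U" using \<Psi>\<Phi> by (intro inj_on_inverseI[of _ \<Psi>]) (auto simp: U_def)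
  have inv: "smooth_on (\<Phi> ` U) (inv_into U \<Phi>)"
  proof (rule smooth_on_cong[OF oim])
    show "smooth_on (\<Phi> ` U) \<Psi>" using smooth_on_subset[OF s\<Psi>] im by blast
    fix y assume "y \<in> \<Phi> ` U"
    then show "\<Psi> y = inv_into U \<Phi> y" using inv_into_f_f[OF inj] \<Psi>\<Phi> by (auto simp: U_def)
  qed
  let ?S = "{t \<in> W. B w t = 0}"
  have S: "subspace ?S" "dim ?S = dim W - 1"
    using subspace_inter[OF W(1) subspace_perp[of w]] dim_perp_within[OF W(1) w(1,3)] by (auto simp: Int_def)
  have nW: "n x \<in> W" if "x \<in> W" for x
    using that w(1) W(1) by (auto simp: n_def intro: subspace_diff subspace_scale)
  have "\<Phi> x \<in> ?S \<longleftrightarrow> x \<in> slice p W" for x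
  proof
    assume x: "x \<in> slice p W"
    then have "n (x - p) \<in> W" by (intro nW) (simp add: slice_def)
    with x show "\<Phi> x \<in> ?S" by (simp add: slice_def \<Phi>_def nlin nw B_diff)
  next
    assume x: "\<Phi> x \<in> ?S"
    then have c: "B x x = B p p" using n\<Phi>(2)[of x] B_sym[of w "\<Phi> x"] w(3) by simp
    with x have "n x - n p \<in> W" by (simp add: \<Phi>_def)
    moreover have "x - p = (n x - n p) + (B (x - p) w / B w w) *\<^sub>R w"
      using split[of "x - p"] by (simp add: nlin)
    ultimately have "x - p \<in> W" using w(1) W(1) by (metis subspace_add subspace_scale)
    with c show "x \<in> slice p W" by (simp add: slice_def)
  qed
  then have "\<Phi> ` (slice p W \<inter> O' \<inter> U) = ?S \<inter> \<Phi> ` U" by (auto simp: U_def)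
  then have "slice_chart (dim W - 1) (slice p W \<inter> O') U \<Phi>"
    unfolding slice_chart_def using oU s\<Phi>[OF oU] inj oim inv S by blast
  moreover have "p \<in> U" using O(2) w(2) by (simp add: U_def)
  ultimately show ?thesis using that by blast
qed

lemma submanifold_slice:
  assumes "pole W p e" "open O'"
  shows "submanifold (dim W - 1) (slice p W \<inter> O')"
  unfolding submanifold_def
proof
  fix x assume x: "x \<in> slice p W \<inter> O'"
  then have "pole W x (e + B e e *\<^sub>R (x - p))" using pole_transfer(1)[OF assms(1)] by blast
  from slice_chart_slice[OF this assms(2)] x
  obtain U \<Phi> where "x \<in> U" "slice_chart (dim W - 1) (slice x W \<inter> O') U \<Phi>" by blast
  moreover have "slice x W = slice p W" using slice_eq[OF poleD(1)[OF assms(1)]] x by blast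
  ultimately show "\<exists>U \<Phi>. x \<in> U \<and> slice_chart (dim W - 1) (slice p W \<inter> O') U \<Phi>" by auto
qed

text \<open>Differentiating the two conditions of the slice gives one inclusion. For the other, the
  line \<open>p + t v\<close> leaves the quadric only to second order and is brought back along
  \<open>e\<close>, which is orthogonal to \<open>v\<close> and transverse to the quadric.\<close>

lemma tangent_space_slice_base:
  assumes e: "pole W p e" and O: "open O'" "p \<in> O'"
  shows "tangent_space (slice p W \<inter> O') p = {v \<in> W. B p v = 0}"
proof safe
  note W = poleD[OF e]
  fix v assume "v \<in> tangent_space (slice p W \<inter> O') p"
  then obtain \<gamma> where g: "\<gamma> (0::real) = p" "(\<gamma> has_vector_derivative v) (at 0)"
      "\<forall>\<^sub>F t in nhds 0. \<gamma> t \<in> slice p W \<inter> O' \<inter> UNIV"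
    by (rule tangent_curve[OF _ open_UNIV UNIV_I])
  show "v \<in> W"
    by (rule vector_derivative_in_subspace[OF W(1) g(2), of p])
      (use g(3) in \<open>auto elim!: eventually_mono simp: slice_def\<close>)
  have "B p v + B v p = 0"
    by (rule has_vector_derivative_eventually_unique[OF has_vector_derivative_B[OF g(2) g(2), unfolded g(1)]
          has_vector_derivative_const[of "B p p"]])
      (use g(3) in \<open>auto elim!: eventually_mono simp: slice_def\<close>)
  then show "B p v = 0" using B_sym[of v p] by simp
next
  note W = poleD[OF e]
  fix v assume v: "v \<in> W" "B p v = 0"
  define r where "r t = 1 - t\<^sup>2 * (B e e * B v v)" for t :: real
  \<comment> \<open>\<open>f\<close> is the root of \<open>e\<^sup>2f\<^sup>2 + 2f + t\<^sup>2v\<^sup>2 = 0\<close> that vanishes at \<open>0\<close>, in a form also valid for \<open>e\<^sup>2 = 0\<close>.\<close>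
  define f where "f t = - t\<^sup>2 * B v v / (1 + sqrt (r t))" for t
  define \<gamma> where "\<gamma> t = p + t *\<^sub>R v + f t *\<^sub>R e" for t
  have o: "open {t. r t > 0}" unfolding r_def by (intro open_Collect_less continuous_intros)
  have pos: "1 + sqrt (r t) > 0" if "r t > 0" for t using that by (simp add: add_pos_pos)
  show "v \<in> tangent_space (slice p W \<inter> O') p"
  proof (rule tangent_spaceI[OF o _ _ O(1)])
    show "smooth_on {t. r t > 0} \<gamma>"
    proof -
      have r: "smooth_on {t. r t > 0} r"
        unfolding r_def power2_eq_square using o[unfolded r_def]
        by (intro smooth_on_diff smooth_on_mult smooth_on_const smooth_on_id) (simp_all add: power2_eq_square)
      have "smooth_on {t. r t > 0} f"
        unfolding f_def power2_eq_square using o r pos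
        by (intro smooth_on_divide smooth_on_mult smooth_on_minus smooth_on_add smooth_on_sqrt smooth_on_const smooth_on_id)
          (auto simp: less_le)
      then show ?thesis
        unfolding \<gamma>_def using o by (intro smooth_on_add smooth_on_scaleR smooth_on_const smooth_on_id)
    qed
  next
    fix t assume t: "t \<in> {t. r t > 0}" and g: "\<gamma> t \<in> O'"
    have ev: "B e v = 0" "B v e = 0" "B v p = 0" "B e p = 1"
      using W(4)[OF v] B_sym[of v e] B_sym[of v p] v(2) B_sym[of e p] W(3) by auto
    have "B (\<gamma> t) (\<gamma> t) = B p p + (B e e * (f t)\<^sup>2 + 2 * f t + t\<^sup>2 * B v v)"
      unfolding \<gamma>_def by (simp add: B_add B_scale ev v(2) W(3) power2_eq_square algebra_simps)
    also have "B e e * (f t)\<^sup>2 + 2 * f t + t\<^sup>2 * B v v = 0"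
    proof -
      define s where "s = sqrt (r t)"
      have s: "1 + s > 0" using pos t by (simp add: s_def)
      have s2: "s\<^sup>2 = 1 - t\<^sup>2 * (B e e * B v v)" using t by (simp add: s_def r_def)
      have f: "f t * (1 + s) = - t\<^sup>2 * B v v" using s by (simp add: f_def s_def)
      \<comment> \<open>Multiplying by \<open>(1 + s)^2\<close> clears the denominators of
        \<open>f\<close>; what remains has a factor that vanishes by the definition of
        \<open>s\<close>.\<close>
      have "(B e e * (f t)\<^sup>2 + 2 * f t + t\<^sup>2 * B v v) * (1 + s)\<^sup>2
          = B e e * (f t * (1 + s))\<^sup>2 + 2 * (f t * (1 + s)) * (1 + s) + t\<^sup>2 * B v v * (1 + s)\<^sup>2"
        by (simp add: power2_eq_square algebra_simps)
      also have "\<dots> = t\<^sup>2 * B v v * (t\<^sup>2 * (B e e * B v v) + s\<^sup>2 - 1)"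
        unfolding f by (simp add: power2_eq_square algebra_simps)
      also have "\<dots> = 0" using s2 by simp
      finally show ?thesis using s by simp
    qed
    finally have "B (\<gamma> t) (\<gamma> t) = B p p" by simp
    moreover have "\<gamma> t - p \<in> W" using v(1) W(1,2) by (auto simp: \<gamma>_def intro: subspace_add subspace_scale)
    ultimately show "\<gamma> t \<in> slice p W \<inter> O'" using g by (simp add: slice_def)
  next
    have "(f has_real_derivative 0) (at 0)"
      unfolding f_def r_def by (auto intro!: derivative_eq_intros)
    then have "(f has_vector_derivative 0) (at 0)" by (simp add: has_real_derivative_iff_has_vector_derivative)
    then have "((\<lambda>t. f t *\<^sub>R e) has_vector_derivative 0 *\<^sub>R e) (at 0)"
      by (rule bounded_linear.has_vector_derivative[OF bounded_linear_scaleR_left])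
    moreover have "((\<lambda>t. p + t *\<^sub>R v) has_vector_derivative v) (at 0)"
      by (auto intro!: derivative_eq_intros)
    ultimately show "(\<gamma> has_vector_derivative v) (at 0)"
      unfolding \<gamma>_def using has_vector_derivative_add by fastforce
  qed (auto simp: r_def \<gamma>_def f_def O)
qed

lemma tangent_space_slice:
  assumes "pole W p e" "open O'" "x \<in> slice p W \<inter> O'"
  shows "tangent_space (slice p W \<inter> O') x = {v \<in> W. B x v = 0}"
  using tangent_space_slice_base[OF pole_transfer(1)[OF assms(1)] assms(2)] assms(3)
    slice_eq[OF poleD(1)[OF assms(1)]] by auto

lemma pr_submanifold_slice:
  assumes "pole W p e" "open O'"
  shows "pr_submanifold B (dim W - 1) (slice p W \<inter> O')"
  unfolding pr_submanifold_def
  using submanifold_slice[OF assms] tangent_space_slice[OF assms] poleD(5)[OF pole_transfer(1)[OF assms(1)]]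
  by auto

section \<open>Curvature of slices\<close>

text \<open>\<open>\<kappa> = 0\<close> stands for the flat space, so that \<open>\<kappa>x - e\<^sub>x\<close> is the mean curvature in both cases.\<close>

definition ambient :: "real \<Rightarrow> 'a set \<Rightarrow> bool" where
  "ambient \<kappa> N \<longleftrightarrow> \<kappa> = 0 \<and> N = UNIV \<or> \<kappa> \<noteq> 0 \<and> N = hyperquadric B \<kappa>"

lemma ambient_square:
  assumes "ambient \<kappa> N" "p \<in> N"
  shows "\<kappa> * (\<kappa> * B p p) = \<kappa>"
  using assms by (auto simp: ambient_def hyperquadric_def)

text \<open>When \<open>W\<close> contains \<open>p\<close>, the position vector is orthogonal to
  the tangent vectors and only has to be scaled. This covers the hyperquadric
  (\<open>W = UNIV\<close>) and \<open>N0\<close> (\<open>W = V None\<close>).\<close>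

lemma pole_hyperquadric:
  assumes "B p p \<noteq> 0" "subspace W" "p \<in> W" "nondegenerate_on B W"
  shows "pole W p (inverse (B p p) *\<^sub>R p)"
  unfolding pole_def
proof (intro conjI ballI impI)
  show "nondegenerate_on B {t \<in> W. B p t = 0}" unfolding nondegenerate_on_def
  proof safe
    fix x assume x: "x \<in> W" "B p x = 0" "\<forall>y\<in>{t \<in> W. B p t = 0}. B x y = 0"
    have "B x y = 0" if "y \<in> W" for y
    proof -
      have "y - (B p y / B p p) *\<^sub>R p \<in> {t \<in> W. B p t = 0}"
        using that assms by (auto simp: B_diff B_scale intro: subspace_diff subspace_scale)
      with x have "B x (y - (B p y / B p p) *\<^sub>R p) = 0" by blast
      then show ?thesis using x(2) B_sym[of x p] by (simp add: B_diff B_scale)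
    qed
    with x(1) assms(4) show "x = 0" unfolding nondegenerate_on_def by blast
  qed
qed (use assms in \<open>auto simp: B_scale subspace_scale\<close>)

lemma slice_UNIV: "slice p UNIV = hyperquadric B (inverse (B p p))"
  by (auto simp: slice_def hyperquadric_def)

lemma tangent_space_ambient:
  assumes "ambient \<kappa> N" "p \<in> N"
  shows "tangent_space N p = {v. \<kappa> * B p v = 0}"
proof (cases "\<kappa> = 0")
  case True then show ?thesis using assms by (simp add: ambient_def tangent_space_UNIV)
next
  case False
  with assms have N: "N = hyperquadric B \<kappa>" and k: "\<kappa> = inverse (B p p)" "B p p \<noteq> 0"
    by (auto simp: ambient_def hyperquadric_def)
  with slice_UNIV[of p] have N: "N = slice p UNIV" by simp
  have "pole UNIV p (inverse (B p p) *\<^sub>R p)" using pole_hyperquadric[OF k(2)] nondeg by simp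
  from tangent_space_slice_base[OF this open_UNIV] show ?thesis using False by (simp add: N)
qed

lemma pr_submanifold_ambient:
  assumes "ambient \<kappa> N" "p \<in> N"
  shows "\<exists>m. pr_submanifold B m N"
proof (cases "\<kappa> = 0")
  case True
  then show ?thesis using assms submanifold_UNIV nondeg
    by (auto simp: ambient_def tangent_space_UNIV pr_submanifold_def)
next
  case False
  with assms have N: "N = hyperquadric B \<kappa>" and k: "\<kappa> = inverse (B p p)" "B p p \<noteq> 0"
    by (auto simp: ambient_def hyperquadric_def)
  with slice_UNIV[of p] have N: "N = slice p UNIV" by simp
  have "pole UNIV p (inverse (B p p) *\<^sub>R p)" using pole_hyperquadric[OF k(2)] nondeg by simp
  from pr_submanifold_slice[OF this open_UNIV] show ?thesis by (auto simp: N)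
qed

lemma slice_subset_ambient: "ambient \<kappa> N \<Longrightarrow> p \<in> N \<Longrightarrow> slice p W \<subseteq> N"
  by (auto simp: ambient_def slice_def hyperquadric_def)

text \<open>What the normal projection requires: its target contains the prospective mean curvature
  \<open>\<kappa> p - e\<close> and is orthogonal to the tangent vectors and to
  \<open>\<kappa> p\<close>. For non-degeneracy, an arbitrary vector is split into a tangent part
  and a rest, and the rest is moved into the normal space along \<open>p\<close>.\<close>

lemma normal_space_slice:
  assumes e: "pole W p e" and N: "ambient \<kappa> N" "p \<in> N"
  defines "S \<equiv> normal_space B N (slice p W) p"
  shows "subspace S" "nondegenerate_on B S" "\<kappa> *\<^sub>R p - e \<in> S" "\<kappa> *\<^sub>R p \<in> orth B S"
    "\<And>t. t \<in> W \<Longrightarrow> B p t = 0 \<Longrightarrow> t \<in> orth B S"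
proof -
  note W = poleD[OF e]
  let ?T = "{t \<in> W. B p t = 0}"
  have S: "S = {v. \<kappa> * B p v = 0} \<inter> orth B ?T"
    unfolding S_def normal_space_def tangent_space_ambient[OF N]
    using tangent_space_slice_base[OF e open_UNIV] by simp
  show "subspace S" unfolding S
    using subspace_inter[OF subspace_perp[of "\<kappa> *\<^sub>R p"] subspace_orth[of ?T]] by (simp add: B_scale)
  have k: "\<kappa> * (\<kappa> * B p p) = \<kappa>" by (rule ambient_square[OF N])
  show "\<kappa> *\<^sub>R p - e \<in> S"
    unfolding S
  proof
    have "\<kappa> * B p (\<kappa> *\<^sub>R p - e) = \<kappa> * (\<kappa> * B p p) - \<kappa>" by (simp add: B_diff B_scale W(3) right_diff_distrib)
    then show "\<kappa> *\<^sub>R p - e \<in> {v. \<kappa> * B p v = 0}" by (simp add: k)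
    show "\<kappa> *\<^sub>R p - e \<in> orth B ?T" using W(4) by (simp add: orth_def B_diff B_scale)
  qed
  show "\<kappa> *\<^sub>R p \<in> orth B S" by (auto simp: S orth_def B_scale)
  show "t \<in> orth B S" if "t \<in> W" "B p t = 0" for t
    unfolding S orth_def
  proof (intro CollectI ballI)
    fix u assume "u \<in> {v. \<kappa> * B p v = 0} \<inter> {v. \<forall>u\<in>?T. B v u = 0}"
    with that have "B u t = 0" by blast
    then show "B t u = 0" using B_sym[of t u] by (rule trans[rotated])
  qed
  show "nondegenerate_on B S" unfolding nondegenerate_on_def
  proof safe
    fix z assume z: "z \<in> S" "\<forall>y\<in>S. B z y = 0"
    show "z = 0"
    proof (rule nondegD)
      fix v
      have T: "subspace ?T" using subspace_inter[OF W(1) subspace_perp[of p]] by (simp add: Int_def)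
      obtain t where t: "t \<in> ?T" "v - t \<in> orth B ?T" using orth_decomposition[OF T W(5)] by blast
      define n where "n = v - t"
      define c where "c = B p n"
      have n: "B n u = 0" if "u \<in> ?T" for u using t(2) that by (auto simp: n_def orth_def)
      have "\<kappa> * B p (n - (\<kappa> * c) *\<^sub>R p) = c * (\<kappa> - \<kappa> * (\<kappa> * B p p))"
        by (simp add: B_diff B_scale c_def algebra_simps)
      \<comment> \<open>By \<open>ambient_square\<close> the correction along \<open>p\<close> makes
        the vector tangent to \<open>N\<close>; for \<open>\<kappa> = 0\<close> it is void.\<close>
      with n have "n - (\<kappa> * c) *\<^sub>R p \<in> S" by (simp add: k S orth_def B_diff B_scale)
      with z(2) have "B z (n - (\<kappa> * c) *\<^sub>R p) = 0" by blast
      then have "B z n = c * (\<kappa> * B z p)" by (simp add: B_diff B_scale mult_ac)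
      moreover have "\<kappa> * B z p = 0" using z(1) B_sym[of z p] by (simp add: S)
      ultimately have "B z n = 0" by simp
      moreover have "B z t = 0" using z(1) t(1) by (auto simp: S orth_def)
      ultimately show "B z v = 0" by (simp add: n_def B_diff)
    qed
  qed
qed

lemma second_fundamental_form_slice:
  assumes e: "pole W p e" and N: "ambient \<kappa> N" "p \<in> N"
    and X: "X \<in> W" "B p X = 0" and Y: "Y \<in> W" "B p Y = 0"
  shows "second_fundamental_form B N (slice p W) p X Y = B X Y *\<^sub>R (\<kappa> *\<^sub>R p - e)"
proof -
  note W = poleD[OF e] and S = normal_space_slice[OF e N]
  let ?M = "slice p W" and ?S = "normal_space B N (slice p W) p"
  have tan: "tangent_space ?M x = {v \<in> W. B x v = 0}" if "x \<in> ?M" for x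
    using tangent_space_slice[OF e open_UNIV] that by simp
  \<comment> \<open>The choice in the definition is made among the extensions of \<open>Y\<close>, so one has to be exhibited.\<close>
  have "tangent_field_extending ?M p Y (\<lambda>q. Y - B q Y *\<^sub>R (e + B e e *\<^sub>R (q - p)))"
    unfolding tangent_field_extending_def
  proof (intro conjI exI ballI)
    show "smooth_on UNIV (\<lambda>q. Y - B q Y *\<^sub>R (e + B e e *\<^sub>R (q - p)))"
      by (intro smooth_on_diff smooth_on_add smooth_on_scaleR smooth_on_B smooth_on_const smooth_on_id open_UNIV)
    fix q assume "q \<in> ?M \<inter> UNIV"
    then have q: "q \<in> ?M" by simp
    from poleD(2,3)[OF pole_transfer(1)[OF e q]]
    show "Y - B q Y *\<^sub>R (e + B e e *\<^sub>R (q - p)) \<in> tangent_space ?M q"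
      unfolding tan[OF q] using Y(1) W(1) by (simp only: mem_Collect_eq B_diff(2) B_scale(2))
        (simp add: subspace_diff subspace_scale)
  qed (use Y in auto)
  then have "tangent_field_extending ?M p Y (SOME F. tangent_field_extending ?M p Y F)"
    by (rule someI[of "tangent_field_extending ?M p Y"])
  then obtain F U where F: "F = (SOME F. tangent_field_extending ?M p Y F)" and U: "open U" "p \<in> U"
      "smooth_on U F" "\<forall>q\<in>?M \<inter> U. F q \<in> tangent_space ?M q" "F p = Y"
    unfolding tangent_field_extending_def by blast
  define D where "D = frechet_derivative F (at p) X"
  have "X \<in> tangent_space ?M p" using X tan slice_self[OF W(1)] by blast
  then obtain \<gamma> where g: "\<gamma> (0::real) = p" "(\<gamma> has_vector_derivative X) (at 0)"
      "\<forall>\<^sub>F t in nhds 0. \<gamma> t \<in> ?M \<inter> U"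
    using tangent_curve U(1,2) by blast
  have Fg: "((\<lambda>t. F (\<gamma> t)) has_vector_derivative D) (at 0)"
    unfolding D_def by (rule derivative_along_curve[OF U(3,1,2) g(1,2)])
  have ev: "\<forall>\<^sub>F t in nhds 0. F (\<gamma> t) \<in> W \<and> B (\<gamma> t) (F (\<gamma> t)) = 0"
    using g(3) by eventually_elim (use U(4) tan in auto)
  have DW: "D \<in> W"
    by (rule vector_derivative_in_subspace[OF W(1) Fg, of 0]) (use ev in \<open>auto elim!: eventually_mono\<close>)
  \<comment> \<open>The derivative at \<open>0\<close> of
    \<open>B (\<gamma> t) (F (\<gamma> t)) = 0\<close>. It makes
    \<open>D + B X Y *\<^sub>R e\<close> tangent to the slice, hence invisible to the normal
    projection.\<close>
  have "B p D + B X Y = 0"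
    by (rule has_vector_derivative_eventually_unique[OF has_vector_derivative_B[OF g(2) Fg, unfolded g(1) U(5)]
          has_vector_derivative_const[of 0]]) (use ev in \<open>auto elim!: eventually_mono\<close>)
  then have "B p (D + B X Y *\<^sub>R e) = 0" using W(3) by (simp add: B_add B_scale)
  moreover have "D + B X Y *\<^sub>R e \<in> W" using DW W(1,2) by (simp add: subspace_add subspace_scale)
  ultimately have "D + B X Y *\<^sub>R e \<in> orth B ?S" using S(5) by blast
  \<comment> \<open>Subtracting a multiple of \<open>\<kappa> p\<close>, which is orthogonal to the
    normal space, turns \<open>- e\<close> into \<open>\<kappa> p - e\<close>, which belongs to
    it.\<close>
  then have "(D + B X Y *\<^sub>R e) - B X Y *\<^sub>R (\<kappa> *\<^sub>R p) \<in> orth B ?S"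
    by (rule subspace_diff[OF subspace_orth _ subspace_scale[OF subspace_orth S(4)]])
  then have "D - B X Y *\<^sub>R (\<kappa> *\<^sub>R p - e) \<in> orth B ?S" by (simp add: algebra_simps)
  from orth_projI[OF S(1,2) _ this] S(1,3)
  show ?thesis
    unfolding second_fundamental_form_def F[symmetric] D_def[symmetric] by (simp add: subspace_scale)
qed

text \<open>Each vector \<open>f\<close> of an orthonormal basis contributes the same vector,
  because \<open>B f f * B f f = 1\<close>, so the average is that vector.\<close>

lemma mean_curvature_slice_base:
  assumes e: "pole W p e" and d: "dim W \<ge> 2" and N: "ambient \<kappa> N" "p \<in> N"
  shows "mean_curvature B N (slice p W) p = \<kappa> *\<^sub>R p - e"
proof -
  note W = poleD[OF e]
  let ?T = "{t \<in> W. B p t = 0}"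
  have tan: "tangent_space (slice p W) p = ?T"
    using tangent_space_slice_base[OF e open_UNIV] by simp
  have T: "subspace ?T" using subspace_inter[OF W(1) subspace_perp[of p]] by (simp add: Int_def)
  \<comment> \<open>Positive dimension matters: for a single point the average would be an empty sum
    times \<open>1 / 0 = 0\<close>.\<close>
  have dT: "dim ?T > 0" using dim_perp_within[OF W(1,2), of p] W(3) d by simp
  define b where "b = (SOME b. orthonormal_basis_of B ?T b)"
  have b: "orthonormal_basis_of B ?T b"
    unfolding b_def by (rule orthonormal_basis_SOME[OF T W(5)])
  have card: "card b = dim ?T"
    using b by (metis orthonormal_basis_of_def dim_span_eq_card_independent)
  have "B f f *\<^sub>R second_fundamental_form B N (slice p W) p f f = \<kappa> *\<^sub>R p - e" if "f \<in> b" for f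
  proof -
    have f: "f \<in> W" "B p f = 0" "B f f * B f f = 1"
      using b that abs_mult_self_eq[of "B f f"] by (auto simp: orthonormal_basis_of_def)
    show ?thesis by (simp add: second_fundamental_form_slice[OF e N f(1,2) f(1,2)] f(3) del: scaleR_diff_right)
  qed
  then have "(\<Sum>f\<in>b. B f f *\<^sub>R second_fundamental_form B N (slice p W) p f f) = real (dim ?T) *\<^sub>R (\<kappa> *\<^sub>R p - e)"
    by (simp add: card[symmetric] sum_constant_scaleR)
  then show ?thesis
    unfolding mean_curvature_def tan b_def[symmetric] using dT by (simp only:) (simp del: dim_eq_0)
qed

lemma mean_curvature_slice:
  assumes e: "pole W p e" and d: "dim W \<ge> 2" and N: "ambient \<kappa> N" "p \<in> N" and x: "x \<in> slice p W"
  shows "mean_curvature B N (slice p W) x = \<kappa> *\<^sub>R x - (e + B e e *\<^sub>R (x - p))"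
  using mean_curvature_slice_base[OF pole_transfer(1)[OF e x] d N(1)] slice_subset_ambient[OF N, of W] x
    slice_eq[OF poleD(1)[OF e] x] by auto

lemma spherical_slice:
  assumes e: "pole W p e" and d: "dim W \<ge> 2" and N: "ambient \<kappa> N" "p \<in> N"
  shows "spherical B N (slice p W)"
  unfolding spherical_def
proof (intro conjI ballI)
  note W = poleD[OF e]
  let ?M = "slice p W"
  let ?F = "\<lambda>x. \<kappa> *\<^sub>R x - (e + B e e *\<^sub>R (x - p))"
  note mc = mean_curvature_slice[OF e d N]
  have tan: "tangent_space ?M x = {v \<in> W. B x v = 0}" if "x \<in> ?M" for x
    using tangent_space_slice[OF e open_UNIV] that by simp
  have pt: "pole W x (e + B e e *\<^sub>R (x - p))" "x \<in> N" "slice x W = ?M" if "x \<in> ?M" for x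
    using pole_transfer(1)[OF e that] slice_subset_ambient[OF N, of W] that slice_eq[OF W(1) that] by auto
  show "?M \<subseteq> N" by (rule slice_subset_ambient[OF N])
  show "\<exists>m. pr_submanifold B m N" by (rule pr_submanifold_ambient[OF N])
  show "\<exists>m. pr_submanifold B m ?M" using pr_submanifold_slice[OF e open_UNIV] by auto
  show "second_fundamental_form B N ?M x X Y = B X Y *\<^sub>R mean_curvature B N ?M x"
    if "x \<in> ?M" "X \<in> tangent_space ?M x" "Y \<in> tangent_space ?M x" for x X Y
    using second_fundamental_form_slice[OF pt(1)[OF that(1)] N(1) pt(2)[OF that(1)]] that
    unfolding tan[OF that(1)] mc[OF that(1)] pt(3)[OF that(1)] by simp
  show "parallel_normal_field B N ?M (mean_curvature B N ?M)"
    unfolding parallel_normal_field_def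
  proof (intro conjI ballI)
    have s: "smooth_on UNIV ?F"
      by (intro smooth_on_diff smooth_on_add smooth_on_scaleR smooth_on_const smooth_on_id open_UNIV)
    show "smooth_map ?M (mean_curvature B N ?M)"
      by (rule smooth_mapI[OF open_UNIV s]) (simp_all add: mc)
    fix x assume x: "x \<in> ?M"
    note S = normal_space_slice[OF pt(1)[OF x] N(1) pt(2)[OF x], unfolded pt(3)[OF x]]
    show "mean_curvature B N ?M x \<in> normal_space B N ?M x" unfolding mc[OF x] by (rule S(3))
    fix X assume X: "X \<in> tangent_space ?M x"
    have "local_extension ?M (mean_curvature B N ?M) x ?F"
      unfolding local_extension_def using s mc by auto
    then have "differential ?M (mean_curvature B N ?M) x X = frechet_derivative ?F (at x) X"
      using X by (rule differential_eq)
    also have "(?F has_derivative (\<lambda>X. \<kappa> *\<^sub>R X - (0 + B e e *\<^sub>R (X - 0)))) (at x)"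
      by (intro derivative_intros)
    from frechet_derivative_at[OF this, symmetric]
    have "frechet_derivative ?F (at x) X = (\<kappa> - B e e) *\<^sub>R X" by (simp add: algebra_simps)
    finally have D: "differential ?M (mean_curvature B N ?M) x X = (\<kappa> - B e e) *\<^sub>R X" .
    have "X \<in> orth B (normal_space B N ?M x)" using S(5) X unfolding tan[OF x] by blast
    then have "(\<kappa> - B e e) *\<^sub>R X - 0 \<in> orth B (normal_space B N ?M x)"
      by (simp add: subspace_orth subspace_scale)
    from orth_projI[OF S(1,2) subspace_0[OF S(1)] this]
    show "orth_proj B (normal_space B N ?M x) (differential ?M (mean_curvature B N ?M) x X) = 0"
      by (simp only: D)
  qed
qed

end

section \<open>Canonical data\<close>

lemma all_option: "(\<forall>j. Q j) \<longleftrightarrow> Q None \<and> (\<forall>i. Q (Some i))"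
  by (metis option.exhaust)

lemma sum_option: "(\<Sum>j\<in>UNIV. f j) = f None + (\<Sum>i\<in>UNIV. f (Some i))"
  for f :: "'i::finite option \<Rightarrow> 'b::comm_monoid_add"
  by (simp add: UNIV_option_conv sum.reindex)

locale canonical_data = scalar_product B
  for B :: "'a::euclidean_space \<Rightarrow> 'a \<Rightarrow> real" +
  fixes pbar :: 'a and V :: "'i::finite option \<Rightarrow> 'a set" and a :: "'i \<Rightarrow> 'a"
  assumes init: "initial_data B pbar V a" and canonical: "canonical_form B pbar V a"
begin

lemma V_subspace: "subspace (V j)"
  and V_orth: "j \<noteq> l \<Longrightarrow> x \<in> V j \<Longrightarrow> y \<in> V l \<Longrightarrow> B x y = 0"
  and V_ex1: "\<exists>!v. (\<forall>j. v j \<in> V j) \<and> x = (\<Sum>j\<in>UNIV. v j)"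
  and V_nontrivial: "V j \<noteq> {0}"
  and a_mem: "a i \<in> V None"
  and a_orth: "i \<noteq> i' \<Longrightarrow> B (a i) (a i') = 0"
  using init by (auto simp: initial_data_def orthogonal_decomposition_def tangent_space_UNIV)

lemma pbar_mem: "pbar \<in> V None" and pbar_a: "B pbar (a i) = 1" "B (a i) pbar = 1"
  using canonical B_sym[of "a i" pbar] by (auto simp: canonical_form_def)

definition comp :: "'i option \<Rightarrow> 'a \<Rightarrow> 'a" where
  "comp j x = (THE v. (\<forall>j. v j \<in> V j) \<and> x = (\<Sum>j\<in>UNIV. v j)) j"

lemma comp_mem: "comp j x \<in> V j" and comp_sum: "(\<Sum>j\<in>UNIV. comp j x) = x"
  using theI'[OF V_ex1[of x]] by (auto simp: comp_def)

lemma comp_unique: "(\<And>j. v j \<in> V j) \<Longrightarrow> x = (\<Sum>j\<in>UNIV. v j) \<Longrightarrow> comp j x = v j"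
  unfolding comp_def by (subst the1_equality[OF V_ex1[of x], of v]) auto

lemma comp_option: "comp None x + (\<Sum>i\<in>UNIV. comp (Some i) x) = x"
  using comp_sum[of x] by (simp add: sum_option)

lemma linear_comp: "linear (comp j)"
proof (rule linearI)
  show "comp j (x + y) = comp j x + comp j y" for x y
    by (rule comp_unique[where v = "\<lambda>j. comp j x + comp j y"])
      (auto intro: subspace_add V_subspace comp_mem simp: sum.distrib comp_sum)
  show "comp j (r *\<^sub>R x) = r *\<^sub>R comp j x" for r x
    by (rule comp_unique[where v = "\<lambda>j. r *\<^sub>R comp j x"])
      (auto intro: subspace_scale V_subspace comp_mem simp: scaleR_right.sum[symmetric] comp_sum)
qed

lemma B_comp:
  assumes "v \<in> V j"
  shows "B v x = B v (comp j x)"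
proof -
  have "B v x = (\<Sum>l\<in>UNIV. B v (comp l x))" by (simp add: B_sum[symmetric] comp_sum)
  also have "\<dots> = (\<Sum>l\<in>UNIV. if l = j then B v (comp j x) else 0)"
    using V_orth[OF _ assms comp_mem] by (intro sum.cong) auto
  finally show ?thesis by simp
qed

text \<open>The summands are mutually orthogonal, so a vector of \<open>V j\<close> orthogonal to
  \<open>V j\<close> is orthogonal to the whole space.\<close>

lemma V_nondegenerate: "nondegenerate_on B (V j)"
  unfolding nondegenerate_on_def
proof (intro ballI impI)
  fix x assume x: "x \<in> V j" "\<forall>y\<in>V j. B x y = 0"
  show "x = 0" by (rule nondegD) (use x B_comp[OF x(1)] comp_mem in auto)
qed

definition W :: "'i \<Rightarrow> 'a set" where "W i = span (insert (a i) (V (Some i)))"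

lemma B_None_Some: "x \<in> V None \<Longrightarrow> y \<in> V (Some i) \<Longrightarrow> B x y = 0"
  "x \<in> V None \<Longrightarrow> y \<in> V (Some i) \<Longrightarrow> B y x = 0"
  by (rule V_orth; simp)+

text \<open>Canonical form enters here: \<open>pbar\<close> is orthogonal to
  \<open>V (Some i)\<close> and pairs to 1 with \<open>a i\<close>, so \<open>B pbar w\<close> reads
  off the \<open>a i\<close>-coefficient of \<open>w\<close>.\<close>

lemma W_iff: "w \<in> W i \<longleftrightarrow> w - B pbar w *\<^sub>R a i \<in> V (Some i)"
proof
  assume "w \<in> W i"
  then obtain s where s: "w - s *\<^sub>R a i \<in> V (Some i)"
    using V_subspace by (auto simp: W_def span_breakdown_eq span_eq_iff[THEN iffD2])
  from B_None_Some(1)[OF pbar_mem this] have "s = B pbar w" by (simp add: B_diff B_scale pbar_a)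
  with s show "w - B pbar w *\<^sub>R a i \<in> V (Some i)" by simp
next
  assume "w - B pbar w *\<^sub>R a i \<in> V (Some i)"
  then show "w \<in> W i" using V_subspace by (auto simp: W_def span_breakdown_eq span_eq_iff[THEN iffD2])
qed

lemma W_subspace: "subspace (W i)" by (simp add: W_def)

lemma V_W: "v \<in> V (Some i) \<Longrightarrow> v \<in> W i" and a_W: "a i \<in> W i"
  by (auto simp: W_def intro: span_base)

lemma W_split:
  assumes "w \<in> W i"
  obtains v where "v \<in> V (Some i)" "w = v + B pbar w *\<^sub>R a i"
  using assms that[of "w - B pbar w *\<^sub>R a i"] by (simp add: W_iff)

lemma B_None_W:
  assumes "x \<in> V None" "w \<in> W i"
  shows "B x w = B pbar w * B x (a i)"
  using B_None_Some(1)[OF assms(1), of "w - B pbar w *\<^sub>R a i" i] assms(2) by (simp add: W_iff B_diff B_scale)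

lemma W_orth:
  assumes "i \<noteq> l" "w \<in> W i" "w' \<in> W l"
  shows "B w w' = 0"
proof -
  obtain v where v: "v \<in> V (Some i)" "w = v + B pbar w *\<^sub>R a i" using assms(2) by (rule W_split)
  obtain v' where v': "v' \<in> V (Some l)" "w' = v' + B pbar w' *\<^sub>R a l" using assms(3) by (rule W_split)
  have "B v v' = 0" "B v (a l) = 0" "B (a i) v' = 0" "B (a i) (a l) = 0"
    using V_orth[OF _ v(1) v'(1)] B_None_Some[OF a_mem v(1)] B_None_Some[OF a_mem v'(1)] a_orth assms(1) by auto
  then show ?thesis by (subst v(2), subst v'(2)) (simp add: B_add B_scale)
qed

lemma dim_W: "dim (W i) = Suc (dim (V (Some i)))" "dim (W i) \<ge> 2"
proof -
  have "a i \<notin> span (V (Some i))"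
    using V_subspace B_None_Some(1)[OF pbar_mem, of "a i"] pbar_a by (auto simp: span_eq_iff[THEN iffD2])
  then show "dim (W i) = Suc (dim (V (Some i)))" by (simp add: W_def dim_insert)
  then show "dim (W i) \<ge> 2"
    using V_nontrivial[of "Some i"] subspace_0[OF V_subspace[of "Some i"]] dim_eq_0[of "V (Some i)"]
    by (cases "dim (V (Some i))") auto
qed

lemma perp_W:
  assumes "\<And>v. v \<in> V (Some i) \<Longrightarrow> B c v = 0" "B c (a i) \<noteq> 0"
  shows "{w \<in> W i. B c w = 0} = V (Some i)"
proof (intro equalityI subsetI)
  fix w assume w: "w \<in> {w \<in> W i. B c w = 0}"
  then obtain v where v: "v \<in> V (Some i)" "w = v + B pbar w *\<^sub>R a i" using W_split by blast
  have "B c w = B pbar w * B c (a i)" by (subst v(2)) (simp add: B_add B_scale assms(1)[OF v(1)])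
  with w assms(2) have "B pbar w = 0" by simp
  with v show "w \<in> V (Some i)" by simp
qed (use assms V_W in auto)

text \<open>Stated for every base point \<open>c\<close> orthogonal to \<open>V (Some i)\<close> but
  not to \<open>a i\<close>, so as to cover the reference points of the leaves besides
  \<open>pbar\<close>. The tangent space is then \<open>V (Some i)\<close>, to which
  \<open>a i\<close> is orthogonal.\<close>

lemma pole_W:
  assumes "\<And>v. v \<in> V (Some i) \<Longrightarrow> B c v = 0" "B c (a i) \<noteq> 0"
  shows "pole (W i) c (inverse (B c (a i)) *\<^sub>R a i)"
  unfolding pole_def perp_W[OF assms]
proof (intro conjI ballI impI)
  show "B (inverse (B c (a i)) *\<^sub>R a i) t = 0" if "t \<in> W i" "B c t = 0" for t
  proof -
    have "t \<in> V (Some i)" using perp_W[OF assms] that by blast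
    then show ?thesis using B_None_Some[OF a_mem] by (simp add: B_scale)
  qed
  show "\<exists>w\<in>W i. B w w \<noteq> 0"
    using ex_nonnull[OF V_subspace V_nondegenerate V_nontrivial] V_W by blast
qed (use assms a_W W_subspace V_nondegenerate in \<open>auto simp: B_scale subspace_scale perp_W[OF assms]\<close>)

lemma pole_W_pbar: "pole (W i) pbar (a i)"
  using pole_W[of i pbar] B_None_Some(1)[OF pbar_mem] by (simp add: pbar_a)

lemma warp_eq: "warp B pbar a i p = B (a i) p"
  by (simp add: warp_def B_diff pbar_a)

lemma factors_None: "factors B pbar V a None = {p \<in> V None. \<forall>i. B (a i) p > 0}"
proof -
  have "p - pbar \<in> V None \<longleftrightarrow> p \<in> V None" for p
    using subspace_add[OF V_subspace _ pbar_mem, of "p - pbar"] subspace_diff[OF V_subspace _ pbar_mem, of p]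
    by auto
  then show ?thesis by (simp add: factors_def warp_eq)
qed

lemma slice_pbar_iff: "pbar + y \<in> slice pbar (W i) \<longleftrightarrow> y \<in> W i \<and> B y y = - 2 * B pbar y"
  using B_sym[of y pbar] by (auto simp: slice_def B_add)

text \<open>For the chord \<open>y\<close> from \<open>pbar\<close> both cases amount to
  \<open>y \<in> W i\<close> and \<open>B y y = - 2 * B pbar y\<close>. If \<open>a i\<close> is
  non-null, this is the sphere equation with shifted centre, as
  \<open>B (a i) y = B pbar y * B (a i) (a i)\<close>; if it is lightlike, the equation forces the
  \<open>a i\<close>-coefficient \<open>- B v v / 2\<close>.\<close>

lemma factors_Some: "factors B pbar V a (Some i) = slice pbar (W i)"
proof (cases "B (a i) (a i) = 0")
  case False
  let ?k = "B (a i) (a i)"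
  have "x \<in> slice pbar (W i) \<longleftrightarrow> x - (pbar - (1 / ?k) *\<^sub>R a i) \<in> {p \<in> W i. B p p = 1 / ?k}" for x
  proof -
    define y where "y = x - pbar"
    have x: "x = pbar + y" by (simp add: y_def)
    have "y + (1 / ?k) *\<^sub>R a i \<in> W i \<longleftrightarrow> y \<in> W i"
      using subspace_diff[OF W_subspace, of "y + (1 / ?k) *\<^sub>R a i" i "(1 / ?k) *\<^sub>R a i"]
        subspace_add[OF W_subspace, of y i "(1 / ?k) *\<^sub>R a i"] subspace_scale[OF W_subspace a_W] by auto
    moreover have "B (y + (1 / ?k) *\<^sub>R a i) (y + (1 / ?k) *\<^sub>R a i) = 1 / ?k \<longleftrightarrow> B y y = - 2 * B pbar y"
      if "y \<in> W i"
    proof -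
      have "B (y + (1 / ?k) *\<^sub>R a i) (y + (1 / ?k) *\<^sub>R a i) = B y y + 2 * B pbar y + 1 / ?k"
        using B_None_W[OF a_mem[of i] that] B_sym[of y "a i"] False by (simp add: B_add B_scale add_divide_distrib)
      then show ?thesis by linarith
    qed
    ultimately show ?thesis unfolding x slice_pbar_iff by (auto simp: algebra_simps)
  qed
  then show ?thesis
    using False by (force simp: factors_def determined_sphere_def W_def image_iff)
next
  case True
  have "x \<in> slice pbar (W i) \<longleftrightarrow> (\<exists>v\<in>V (Some i). x = pbar + (v - (B v v / 2) *\<^sub>R a i))" for x
  proof
    assume x: "x \<in> slice pbar (W i)"
    define y where "y = x - pbar"
    have y: "y \<in> W i" "B y y = - 2 * B pbar y" using x slice_pbar_iff[of y i] by (auto simp: y_def)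
    obtain v where v: "v \<in> V (Some i)" "y = v + B pbar y *\<^sub>R a i" using y(1) by (rule W_split)
    have "B y y = B v v"
      by (subst v(2), subst (2) v(2)) (simp add: B_add B_scale True B_None_Some[OF a_mem v(1)])
    with y(2) have "B pbar y = - (B v v / 2)" by simp
    with v have "y = v - (B v v / 2) *\<^sub>R a i" by (metis add.commute scaleR_minus_left uminus_add_conv_diff)
    then have "x = pbar + (v - (B v v / 2) *\<^sub>R a i)" by (simp add: y_def algebra_simps)
    with v(1) show "\<exists>v\<in>V (Some i). x = pbar + (v - (B v v / 2) *\<^sub>R a i)" by blast
  next
    assume "\<exists>v\<in>V (Some i). x = pbar + (v - (B v v / 2) *\<^sub>R a i)"
    then obtain v where v: "v \<in> V (Some i)" "x = pbar + (v - (B v v / 2) *\<^sub>R a i)" by blast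
    have "v - (B v v / 2) *\<^sub>R a i \<in> W i"
      using v(1) V_W a_W by (auto intro!: subspace_diff subspace_scale W_subspace)
    then show "x \<in> slice pbar (W i)" unfolding v(2) slice_pbar_iff
      by (simp add: B_diff B_scale True B_None_Some[OF a_mem v(1)] B_None_Some[OF pbar_mem v(1)] pbar_a)
  qed
  then show ?thesis using True by (auto simp: factors_def determined_sphere_def)
qed

section \<open>The associated map in canonical form and its square\<close>

abbreviation "P \<equiv> product_manifold (factors B pbar V a)"
abbreviation "\<psi> \<equiv> associated_map B pbar a"

lemma mem_P: "x \<in> P \<longleftrightarrow> x $ None \<in> V None \<and> (\<forall>i. B (a i) (x $ None) > 0) \<and> (\<forall>i. x $ Some i \<in> slice pbar (W i))"
  unfolding product_manifold_def by (auto simp: all_option factors_None factors_Some)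

lemma psi_eq: "\<psi> x = x $ None + (\<Sum>i\<in>UNIV. B (a i) (x $ None) *\<^sub>R (x $ Some i - pbar))"
  by (simp add: associated_map_def warp_eq)

text \<open>The \<open>W i\<close> are mutually orthogonal and \<open>V None\<close> meets them only
  through their \<open>a i\<close>-parts, so no terms with two different indices survive. Serves
  both the square of \<open>\<psi>\<close> and its isometry property.\<close>

lemma B_sum_W:
  assumes "x \<in> V None" "y \<in> V None" "\<And>i. z i \<in> W i" "\<And>i. w i \<in> W i"
  shows "B (x + (\<Sum>i\<in>UNIV. z i)) (y + (\<Sum>i\<in>UNIV. w i)) =
    B x y + (\<Sum>i\<in>UNIV. B pbar (w i) * B (a i) x + B pbar (z i) * B (a i) y + B (z i) (w i))"
proof -
  have "B (\<Sum>i\<in>UNIV. z i) (\<Sum>i\<in>UNIV. w i) = (\<Sum>i\<in>UNIV. \<Sum>l\<in>UNIV. B (z i) (w l))"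
    unfolding B_sum(1) unfolding B_sum(2) ..
  also have "\<dots> = (\<Sum>i\<in>UNIV. \<Sum>l\<in>UNIV. if l = i then B (z i) (w i) else 0)"
    using W_orth[OF _ assms(3,4)] by (intro sum.cong) auto
  finally have "B (\<Sum>i\<in>UNIV. z i) (\<Sum>i\<in>UNIV. w i) = (\<Sum>i\<in>UNIV. B (z i) (w i))" by simp
  moreover have "B x (w i) = B pbar (w i) * B (a i) x" "B (z i) y = B pbar (z i) * B (a i) y" for i
    using B_None_W[OF assms(1,4)] B_None_W[OF assms(2,3)] B_sym[of x "a i"] B_sym[of y "a i"] B_sym[of "z i" y]
    by auto
  ultimately show ?thesis by (simp add: B_add B_sum sum.distrib)
qed

lemma slice_chord_mem:
  assumes "x \<in> slice pbar (W i)"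
  shows "x - pbar \<in> W i" "B (x - pbar) (x - pbar) = - 2 * B pbar (x - pbar)"
  using assms slice_chord by (auto simp: slice_def)

text \<open>For each \<open>i\<close> the two mixed terms of \<open>w i\<close> with the first
  coordinate cancel the square of \<open>w i\<close>, by the chord equation of the
  \<open>i\<close>-th sphere.\<close>

lemma psi_square:
  assumes "x \<in> P"
  shows "B (\<psi> x) (\<psi> x) = B (x $ None) (x $ None)"
proof -
  have x: "x $ None \<in> V None" "\<And>i. x $ Some i \<in> slice pbar (W i)" using assms by (auto simp: mem_P)
  note y = slice_chord_mem[OF x(2)]
  define w where "w i = B (a i) (x $ None) *\<^sub>R (x $ Some i - pbar)" for i
  have w: "w i \<in> W i" "B pbar (w i) = B (a i) (x $ None) * B pbar (x $ Some i - pbar)"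
    "B (w i) (w i) = - 2 * (B (a i) (x $ None))\<^sup>2 * B pbar (x $ Some i - pbar)" for i
    using y W_subspace by (auto simp: w_def subspace_scale B_scale power2_eq_square)
  have "\<psi> x = x $ None + (\<Sum>i\<in>UNIV. w i)" by (simp add: psi_eq w_def)
  then have "B (\<psi> x) (\<psi> x) = B (x $ None) (x $ None) +
      (\<Sum>i\<in>UNIV. B pbar (w i) * B (a i) (x $ None) + B pbar (w i) * B (a i) (x $ None) + B (w i) (w i))"
    using B_sum_W[OF x(1,1) w(1,1)] by (simp only:)
  also have "(\<Sum>i\<in>UNIV. B pbar (w i) * B (a i) (x $ None) + B pbar (w i) * B (a i) (x $ None) + B (w i) (w i)) = 0"
    by (rule sum.neutral) (simp only: w(2,3), simp add: power2_eq_square)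
  finally show ?thesis by simp
qed

end

section \<open>The associated map, its inverse and its leaves\<close>

lemma tangent_space_product:
  fixes M :: "'i::finite option \<Rightarrow> 'a::euclidean_space set"
  assumes "X \<in> tangent_space (product_manifold M) x"
  shows "X $ j \<in> tangent_space (M j) (x $ j)"
proof -
  obtain \<gamma> and e :: real where g: "e > 0" "smooth_on {-e<..<e} \<gamma>" "\<gamma> ` {-e<..<e} \<subseteq> product_manifold M"
      "\<gamma> 0 = x" "(\<gamma> has_vector_derivative X) (at 0)"
    using assms unfolding tangent_space_def by auto
  have "smooth_on {-e<..<e} (\<lambda>t. \<gamma> t $ j)"
    by (rule smooth_on_linear[OF linear_vec_nth open_greaterThanLessThan g(2)])
  moreover have "((\<lambda>t. \<gamma> t $ j) has_vector_derivative X $ j) (at 0)"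
    by (rule bounded_linear.has_vector_derivative[OF bounded_linear_vec_nth g(5)])
  moreover have "(\<lambda>t. \<gamma> t $ j) ` {-e<..<e} \<subseteq> M j"
    using g(3) by (auto simp: product_manifold_def)
  ultimately show ?thesis unfolding tangent_space_def using g(1,4) by blast
qed

definition vec_upd :: "'b ^ 'j \<Rightarrow> 'j \<Rightarrow> 'b \<Rightarrow> 'b ^ 'j" where
  "vec_upd x j u = (\<chi> l. if l = j then u else x $ l)"

lemma vec_upd_nth: "vec_upd x j u $ l = (if l = j then u else x $ l)"
  by (simp add: vec_upd_def)

text \<open>By injectivity \<open>p\<close> has the single preimage \<open>x\<close>, so the leaf is
  the image of one factor with the other coordinates frozen.\<close>

lemma leaf_eq:
  assumes "inj_on f (product_manifold M)" "x \<in> product_manifold M" "f x = p"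
  shows "leaf M f j p = (\<lambda>u. f (vec_upd x j u)) ` M j"
proof (intro equalityI subsetI)
  fix z assume "z \<in> leaf M f j p"
  then obtain x' y where "x' \<in> product_manifold M" "f x' = p" and y: "z = f y" "y \<in> product_manifold M"
      "\<forall>l. l \<noteq> j \<longrightarrow> y $ l = x' $ l"
    unfolding leaf_def by blast
  then have "x' = x" using assms by (metis inj_onD)
  with y(3) have "y = vec_upd x j (y $ j)" by (simp add: vec_eq_iff vec_upd_nth)
  moreover have "y $ j \<in> M j" using y(2) by (simp add: product_manifold_def)
  ultimately show "z \<in> (\<lambda>u. f (vec_upd x j u)) ` M j" using y(1) by (metis imageI)
next
  fix z assume "z \<in> (\<lambda>u. f (vec_upd x j u)) ` M j"
  then obtain u where u: "u \<in> M j" "z = f (vec_upd x j u)" by blast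
  moreover have "vec_upd x j u \<in> product_manifold M"
    using u(1) assms(2) by (simp add: product_manifold_def vec_upd_nth)
  moreover have "\<forall>l. l \<noteq> j \<longrightarrow> vec_upd x j u $ l = x $ l" by (simp add: vec_upd_nth)
  ultimately show "z \<in> leaf M f j p" unfolding leaf_def using assms(2,3) by blast
qed

context canonical_data
begin

section \<open>Components of the image and the explicit inverse\<close>

lemma psi_components:
  assumes "x \<in> P"
  defines "y \<equiv> \<lambda>i. x $ Some i - pbar" and "\<rho> \<equiv> \<lambda>i. B (a i) (x $ None)"
  shows "comp (Some i) (\<psi> x) = \<rho> i *\<^sub>R (y i - B pbar (y i) *\<^sub>R a i)"
    and "comp None (\<psi> x) = x $ None + (\<Sum>i\<in>UNIV. (\<rho> i * B pbar (y i)) *\<^sub>R a i)"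
proof -
  have x: "x $ None \<in> V None" "\<And>i. x $ Some i \<in> slice pbar (W i)" using assms by (auto simp: mem_P)
  define v where "v j = (case j of None \<Rightarrow> x $ None + (\<Sum>i\<in>UNIV. (\<rho> i * B pbar (y i)) *\<^sub>R a i)
    | Some i \<Rightarrow> \<rho> i *\<^sub>R (y i - B pbar (y i) *\<^sub>R a i))" for j
  have "v j \<in> V j" for j
  proof (cases j)
    case None
    then show ?thesis
      using x(1) by (auto simp: v_def intro!: subspace_add subspace_sum subspace_scale V_subspace a_mem)
  next
    case (Some i)
    then show ?thesis
      using slice_chord_mem(1)[OF x(2)[of i]] by (simp add: v_def y_def subspace_scale V_subspace W_iff)
  qed
  moreover have "\<psi> x = (\<Sum>j\<in>UNIV. v j)"
    by (simp add: sum_option v_def psi_eq scaleR_diff_right sum_subtractf \<rho>_def y_def)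
  ultimately have "comp j (\<psi> x) = v j" for j by (rule comp_unique)
  then show "comp (Some i) (\<psi> x) = \<rho> i *\<^sub>R (y i - B pbar (y i) *\<^sub>R a i)"
    and "comp None (\<psi> x) = x $ None + (\<Sum>i\<in>UNIV. (\<rho> i * B pbar (y i)) *\<^sub>R a i)"
    by (simp_all add: v_def)
qed

text \<open>On the image of \<open>\<psi>\<close>, \<open>disc i\<close> is \<open>\<rho>\<^sub>i\<^sup>2\<close> and \<open>pole_coord i\<close> is the \<open>a\<^sub>i\<close>-coefficient of \<open>p\<^sub>i - pbar\<close>.\<close>

definition disc :: "'i \<Rightarrow> 'a \<Rightarrow> real" where
  "disc i z = (B (a i) z)\<^sup>2 + B (a i) (a i) * B (comp (Some i) z) (comp (Some i) z)"

definition pole_coord :: "'i \<Rightarrow> 'a \<Rightarrow> real" where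
  "pole_coord i z =
     (if B (a i) (a i) = 0 then - B (comp (Some i) z) (comp (Some i) z) / (2 * disc i z)
      else (B (a i) z / sqrt (disc i z) - 1) / B (a i) (a i))"

definition psi_inv :: "'a \<Rightarrow> 'a ^ 'i option" where
  "psi_inv z = (\<chi> j. case j of
      None \<Rightarrow> comp None z - (\<Sum>i\<in>UNIV. (sqrt (disc i z) * pole_coord i z) *\<^sub>R a i)
    | Some i \<Rightarrow> pbar + ((1 / sqrt (disc i z)) *\<^sub>R comp (Some i) z + pole_coord i z *\<^sub>R a i))"

text \<open>For lightlike \<open>a i\<close>, \<open>disc i z\<close> is the square of
  \<open>B (a i) z\<close> and loses its sign, which must be required separately; for non-null
  \<open>a i\<close> both signs occur in the image.\<close>

definition psi_range :: "'a set" where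
  "psi_range = {z. \<forall>i. disc i z > 0 \<and> (B (a i) (a i) = 0 \<longrightarrow> B (a i) z > 0)}"

lemma B_a_sum: "B (a i) (\<Sum>l\<in>UNIV. f l *\<^sub>R a l) = f i * B (a i) (a i)"
proof -
  have "B (a i) (\<Sum>l\<in>UNIV. f l *\<^sub>R a l) = (\<Sum>l\<in>UNIV. if l = i then f i * B (a i) (a i) else 0)"
    unfolding B_sum using a_orth by (intro sum.cong) (auto simp: B_scale)
  then show ?thesis by simp
qed

lemma psi_inv_psi:
  assumes "x \<in> P"
  shows "\<psi> x \<in> psi_range" "psi_inv (\<psi> x) = x"
proof -
  have x: "x $ None \<in> V None" "\<And>i. B (a i) (x $ None) > 0" "\<And>i. x $ Some i \<in> slice pbar (W i)"
    using assms by (auto simp: mem_P)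
  define s where "s i = B pbar (x $ Some i - pbar)" for i
  define v where "v i = x $ Some i - pbar - s i *\<^sub>R a i" for i
  define \<rho> where "\<rho> i = B (a i) (x $ None)" for i
  note y = slice_chord_mem[OF x(3), folded s_def]
  have v: "v i \<in> V (Some i)" "x $ Some i - pbar = v i + s i *\<^sub>R a i" for i
    using y(1)[of i] by (auto simp: v_def s_def W_iff)
  have c: "comp (Some i) (\<psi> x) = \<rho> i *\<^sub>R v i"
    "comp None (\<psi> x) = x $ None + (\<Sum>i\<in>UNIV. (\<rho> i * s i) *\<^sub>R a i)" for i
    using psi_components[OF assms, folded s_def \<rho>_def] by (auto simp: v_def s_def \<rho>_def)
  \<comment> \<open>The chord equation of the sphere in the coordinates \<open>v i\<close>,
    \<open>s i\<close>. It reduces \<open>disc\<close> to \<open>\<rho>^2\<close>, and for lightlike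
    \<open>a i\<close> it gives \<open>s i = - B (v i) (v i) / 2\<close>.\<close>
  have sph: "B (v i) (v i) + (s i)\<^sup>2 * B (a i) (a i) = - 2 * s i" for i
  proof -
    have "B (v i + s i *\<^sub>R a i) (v i + s i *\<^sub>R a i) = B (v i) (v i) + (s i)\<^sup>2 * B (a i) (a i)"
      by (simp add: B_add B_scale B_None_Some[OF a_mem v(1)] power2_eq_square)
    then show ?thesis using y(2)[of i] by (simp only: v(2)[symmetric])
  qed
  have az: "B (a i) (\<psi> x) = \<rho> i * (1 + s i * B (a i) (a i))" for i
    unfolding B_comp[OF a_mem, of _ "\<psi> x"] c(2) by (simp add: B_add B_a_sum \<rho>_def algebra_simps)
  have disc: "disc i (\<psi> x) = (\<rho> i)\<^sup>2" for i
  proof -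
    have "disc i (\<psi> x) = (\<rho> i)\<^sup>2 * (1 + B (a i) (a i) * (B (v i) (v i) + (s i)\<^sup>2 * B (a i) (a i) + 2 * s i))"
      unfolding disc_def az c(1) by (simp add: B_scale power2_eq_square algebra_simps)
    then show ?thesis by (simp add: sph)
  qed
  have \<rho>: "\<rho> i > 0" for i using x(2) by (simp add: \<rho>_def)
  then have sq: "sqrt (disc i (\<psi> x)) = \<rho> i" for i by (simp add: disc less_imp_le)
  have pc: "pole_coord i (\<psi> x) = s i" for i
    using sph[of i] \<rho>[of i] unfolding pole_coord_def sq disc az c(1)
    by (auto simp: B_scale power2_eq_square)
  show "\<psi> x \<in> psi_range" unfolding psi_range_def by (auto simp: disc az \<rho> less_imp_neq[OF \<rho>, symmetric])
  have "psi_inv (\<psi> x) $ j = x $ j" for j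
  proof (cases j)
    case None
    then show ?thesis by (simp add: psi_inv_def sq pc c(2))
  next
    case (Some i)
    then have "psi_inv (\<psi> x) $ j = pbar + (v i + s i *\<^sub>R a i)"
      using \<rho>[of i] by (simp add: psi_inv_def sq pc c(1))
    then show ?thesis using v(2)[of i] Some by (simp add: algebra_simps)
  qed
  then show "psi_inv (\<psi> x) = x" by (simp add: vec_eq_iff)
qed

lemma psi_psi_inv:
  assumes "z \<in> psi_range"
  shows "psi_inv z \<in> P" "\<psi> (psi_inv z) = z"
proof -
  define r where "r i = sqrt (disc i z)" for i
  define k where "k i = B (a i) (a i)" for i
  define s where "s i = pole_coord i z" for i
  define c where "c i = comp (Some i) z" for i
  have disc: "disc i z > 0" "k i = 0 \<longrightarrow> B (a i) z > 0" for i
    using assms by (auto simp: psi_range_def k_def)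
  have r: "r i > 0" "(r i)\<^sup>2 = (B (a i) z)\<^sup>2 + k i * B (c i) (c i)" for i
    using disc(1)[of i] by (auto simp: r_def disc_def k_def c_def)
  have c: "c i \<in> V (Some i)" for i by (simp add: c_def comp_mem)
  have nth: "psi_inv z $ None = comp None z - (\<Sum>i\<in>UNIV. (r i * s i) *\<^sub>R a i)"
    "psi_inv z $ Some i = pbar + ((1 / r i) *\<^sub>R c i + s i *\<^sub>R a i)" for i
    by (auto simp: psi_inv_def r_def s_def c_def)
  have s0: "s i = - B (c i) (c i) / (2 * (r i)\<^sup>2)" if "k i = 0" for i
    using that disc(1)[of i] by (simp add: s_def pole_coord_def k_def c_def r_def)
  have s1: "r i * s i * k i = B (a i) z - r i" if "k i \<noteq> 0" for i
    using that r(1)[of i] by (simp add: s_def pole_coord_def k_def[symmetric] r_def[symmetric] field_simps)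
  \<comment> \<open>The multiples of the \<open>a l\<close> subtracted in the first coordinate are
    chosen so that its warping values are the roots \<open>r i\<close>.\<close>
  have \<rho>: "B (a i) (psi_inv z $ None) = r i" for i
  proof -
    have "B (a i) (psi_inv z $ None) = B (a i) z - r i * s i * k i"
      unfolding nth(1) B_diff B_a_sum B_comp[OF a_mem, of _ z, symmetric] by (simp add: k_def)
    moreover have "r i * s i * k i = B (a i) z - r i"
    proof (cases "k i = 0")
      case True
      \<comment> \<open>The root only gives the absolute value of \<open>B (a i) z\<close>; the sign
        condition in \<open>psi_range\<close> decides.\<close>
      then have "r i = B (a i) z" using r[of i] disc(2)[of i] by (simp add: power2_eq_iff)
      with True show ?thesis by simp
    qed (rule s1)
    ultimately show ?thesis by simp
  qed
  have sph: "(1 / r i) *\<^sub>R c i + s i *\<^sub>R a i \<in> W i \<and>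
      B ((1 / r i) *\<^sub>R c i + s i *\<^sub>R a i) ((1 / r i) *\<^sub>R c i + s i *\<^sub>R a i) = - 2 * B pbar ((1 / r i) *\<^sub>R c i + s i *\<^sub>R a i)" for i
  proof
    show "(1 / r i) *\<^sub>R c i + s i *\<^sub>R a i \<in> W i"
      using V_W[OF c] a_W by (auto intro!: subspace_add subspace_scale W_subspace)
    \<comment> \<open>The sphere equation multiplied by \<open>(r i)^2\<close>. For non-null
      \<open>a i\<close> it is proved after a further multiplication by \<open>k i\<close>, so that
      \<open>s1\<close> applies.\<close>
    have "B (c i) (c i) + (r i * s i)\<^sup>2 * k i = - 2 * s i * (r i)\<^sup>2"
    proof (cases "k i = 0")
      case True
      then show ?thesis using s0[OF True] r(1)[of i] by (simp add: field_simps)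
    next
      case False
      have "k i * (B (c i) (c i) + (r i * s i)\<^sup>2 * k i) = ((r i)\<^sup>2 - (B (a i) z)\<^sup>2) + (r i * s i * k i)\<^sup>2"
        using r(2)[of i] by (simp add: power2_eq_square algebra_simps)
      also have "\<dots> = (r i)\<^sup>2 - (B (a i) z)\<^sup>2 + (B (a i) z - r i)\<^sup>2" by (simp add: s1[OF False])
      also have "\<dots> = - 2 * r i * (B (a i) z - r i)" by (simp add: power2_eq_square algebra_simps)
      also have "\<dots> = - 2 * r i * (r i * s i * k i)" by (simp add: s1[OF False])
      also have "\<dots> = k i * (- 2 * s i * (r i)\<^sup>2)" by (simp add: power2_eq_square)
      finally show ?thesis using False by (simp only: mult_cancel_left) simp
    qed
    then have "B (c i) (c i) / (r i)\<^sup>2 + (s i)\<^sup>2 * k i = - 2 * s i"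
      using r(1)[of i] by (simp add: field_simps power_mult_distrib)
    then show "B ((1 / r i) *\<^sub>R c i + s i *\<^sub>R a i) ((1 / r i) *\<^sub>R c i + s i *\<^sub>R a i) = - 2 * B pbar ((1 / r i) *\<^sub>R c i + s i *\<^sub>R a i)"
      by (simp add: B_add B_scale B_None_Some[OF a_mem c] B_None_Some[OF pbar_mem c] pbar_a k_def power2_eq_square)
  qed
  have "psi_inv z $ None \<in> V None"
    unfolding nth(1) by (auto intro!: subspace_diff subspace_sum subspace_scale V_subspace a_mem comp_mem)
  with \<rho> r(1) sph show "psi_inv z \<in> P" by (simp add: mem_P nth(2) slice_pbar_iff)
  have "r i *\<^sub>R ((1 / r i) *\<^sub>R c i + s i *\<^sub>R a i) = c i + (r i * s i) *\<^sub>R a i" for i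
    using r(1)[of i] by (simp add: scaleR_add_right)
  then have "\<psi> (psi_inv z) = comp None z + (\<Sum>i\<in>UNIV. c i)"
    unfolding psi_eq \<rho> unfolding nth by (simp add: sum.distrib)
  then show "\<psi> (psi_inv z) = z" by (simp add: c_def comp_option)
qed

lemma psi_image: "\<psi> ` P = psi_range"
  using psi_inv_psi(1) psi_psi_inv by (metis image_eqI image_subsetI subsetI subset_antisym)

lemma inj_on_psi: "inj_on \<psi> P"
  using psi_inv_psi(2) by (rule inj_on_inverseI)

lemma smooth_on_comp: "open S \<Longrightarrow> smooth_on S (comp j)"
  using smooth_on_linear[OF linear_comp _ smooth_on_id] by simp

lemma smooth_on_disc: "open S \<Longrightarrow> smooth_on S (disc i)"
  unfolding disc_def power2_eq_square
  by (intro smooth_on_add smooth_on_mult smooth_on_B smooth_on_const smooth_on_id smooth_on_comp)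

lemma open_psi_range: "open psi_range"
proof -
  have c: "continuous_on UNIV (disc i)" "continuous_on UNIV (B (a i))" for i
    using smooth_on_imp_continuous_on[OF smooth_on_disc[OF open_UNIV]]
      smooth_on_imp_continuous_on[OF smooth_on_B[OF open_UNIV smooth_on_const smooth_on_id]] by auto
  have "psi_range = (\<Inter>i. {z. disc i z > 0} \<inter> (if B (a i) (a i) = 0 then {z. B (a i) z > 0} else UNIV))"
  proof -
    have "z \<in> (if c then A else UNIV) \<longleftrightarrow> (c \<longrightarrow> z \<in> A)" for z c and A :: "'a set" by simp
    then show ?thesis unfolding psi_range_def by (simp only: set_eq_iff INT_iff Int_iff mem_Collect_eq) blast
  qed
  also have "open \<dots>"
    by (intro open_INT finite ballI open_Int open_Collect_less c continuous_on_const) (auto intro: open_Collect_less c continuous_on_const)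
  finally show ?thesis .
qed

lemma smooth_on_psi_inv: "smooth_on psi_range psi_inv"
proof -
  note o = open_psi_range
  have d: "smooth_on psi_range (\<lambda>z. sqrt (disc i z))" for i
    by (rule smooth_on_sqrt[OF o smooth_on_disc[OF o]]) (auto simp: psi_range_def)
  have pos: "disc i z > 0" "sqrt (disc i z) \<noteq> 0" if "z \<in> psi_range" for i z
    using that by (auto simp: psi_range_def less_le)
  have s: "smooth_on psi_range (pole_coord i)" for i
  proof (cases "B (a i) (a i) = 0")
    case True
    have "smooth_on psi_range (\<lambda>z. - B (comp (Some i) z) (comp (Some i) z) / (2 * disc i z))"
      by (intro smooth_on_divide smooth_on_minus smooth_on_mult smooth_on_B smooth_on_const smooth_on_comp smooth_on_disc o)
        (use pos in force)
    then show ?thesis unfolding pole_coord_def using True by simp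
  next
    case False
    have "smooth_on psi_range (\<lambda>z. (B (a i) z / sqrt (disc i z) - 1) / B (a i) (a i))"
      by (intro smooth_on_divide smooth_on_diff smooth_on_B smooth_on_const smooth_on_id d o)
        (use pos False in force)+
    then show ?thesis unfolding pole_coord_def using False by simp
  qed
  show ?thesis
    unfolding psi_inv_def
  proof (rule smooth_on_vec[OF o])
    fix j
    show "smooth_on psi_range (\<lambda>z. case j of
      None \<Rightarrow> comp None z - (\<Sum>i\<in>UNIV. (sqrt (disc i z) * pole_coord i z) *\<^sub>R a i)
    | Some i \<Rightarrow> pbar + ((1 / sqrt (disc i z)) *\<^sub>R comp (Some i) z + pole_coord i z *\<^sub>R a i))"
    proof (cases j)
      case None
      have "smooth_on psi_range (\<lambda>z. comp None z - (\<Sum>i\<in>UNIV. (sqrt (disc i z) * pole_coord i z) *\<^sub>R a i))"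
        by (intro smooth_on_diff smooth_on_sum smooth_on_scaleR smooth_on_mult smooth_on_const smooth_on_comp d s o)
      with None show ?thesis by simp
    next
      case (Some i)
      have "smooth_on psi_range (\<lambda>z. pbar + ((1 / sqrt (disc i z)) *\<^sub>R comp (Some i) z + pole_coord i z *\<^sub>R a i))"
        by (intro smooth_on_add smooth_on_scaleR smooth_on_divide smooth_on_const smooth_on_comp d s o pos)
      with Some show ?thesis by simp
    qed
  qed
qed

section \<open>Smoothness, differential and leaves of the associated map\<close>

lemma smooth_on_psi: "smooth_on UNIV \<psi>"
proof -
  have n: "smooth_on UNIV (\<lambda>x::'a ^ 'i option. x $ j)" for j
    by (rule smooth_on_linear[OF linear_vec_nth open_UNIV smooth_on_id])
  have "smooth_on UNIV (\<lambda>x. x $ None + (\<Sum>i\<in>UNIV. B (a i) (x $ None) *\<^sub>R (x $ Some i - pbar)))"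
    by (intro smooth_on_add smooth_on_sum smooth_on_scaleR smooth_on_diff smooth_on_B smooth_on_const n open_UNIV)
  then show ?thesis by (simp add: psi_eq[abs_def])
qed

lemma frechet_derivative_psi:
  "frechet_derivative \<psi> (at x) = (\<lambda>X. X $ None + (\<Sum>i\<in>UNIV.
      B (a i) (x $ None) *\<^sub>R X $ Some i + B (a i) (X $ None) *\<^sub>R (x $ Some i - pbar)))"
proof -
  have n: "((\<lambda>x::'a ^ 'i option. x $ j) has_derivative (\<lambda>X. X $ j)) (at x)" for j
    by (rule bounded_linear_imp_has_derivative[OF bounded_linear_vec_nth])
  have "((\<lambda>x. B (a i) (x $ None)) has_derivative (\<lambda>X. B (a i) (X $ None))) (at x)" for i
    by (rule bounded_linear.has_derivative[OF bounded_bilinear.bounded_linear_right[OF bounded_bilinear_B] n])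
  from has_derivative_scaleR[OF this has_derivative_diff[OF n has_derivative_const]]
  have "((\<lambda>x. B (a i) (x $ None) *\<^sub>R (x $ Some i - pbar)) has_derivative
      (\<lambda>X. B (a i) (x $ None) *\<^sub>R X $ Some i + B (a i) (X $ None) *\<^sub>R (x $ Some i - pbar))) (at x)" for i
    by simp
  then have "(\<psi> has_derivative (\<lambda>X. X $ None + (\<Sum>i\<in>UNIV.
      B (a i) (x $ None) *\<^sub>R X $ Some i + B (a i) (X $ None) *\<^sub>R (x $ Some i - pbar)))) (at x)"
    unfolding psi_eq[abs_def] by (intro has_derivative_add n has_derivative_sum)
  then show ?thesis by (rule frechet_derivative_at[symmetric])
qed

text \<open>The differential is a vector of \<open>V None\<close> plus vectors of the
  \<open>W i\<close>, so \<open>B_sum_W\<close> applies. The terms with a derivative of a warping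
  function cancel by the tangency conditions and the chord equation.\<close>

lemma psi_isometry:
  assumes x: "x \<in> P"
    and X: "X $ None \<in> V None" "\<And>i. X $ Some i \<in> W i" "\<And>i. B (x $ Some i) (X $ Some i) = 0"
    and Y: "Y $ None \<in> V None" "\<And>i. Y $ Some i \<in> W i" "\<And>i. B (x $ Some i) (Y $ Some i) = 0"
  shows "B (frechet_derivative \<psi> (at x) X) (frechet_derivative \<psi> (at x) Y) =
    warped_metric B (warp B pbar a) x X Y"
proof -
  define y where "y i = x $ Some i - pbar" for i
  define dz where "dz X i = B (a i) (x $ None) *\<^sub>R X $ Some i + B (a i) (X $ None) *\<^sub>R y i" for X i
  have "x $ Some i \<in> slice pbar (W i)" for i using x by (simp add: mem_P)
  note y = slice_chord_mem[OF this, folded y_def]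
  have dW: "dz X i \<in> W i" "dz Y i \<in> W i" for i
    using X(2) Y(2) y(1) by (auto simp: dz_def intro!: subspace_add subspace_scale W_subspace)
  have yX: "B (y i) (X $ Some i) = - B pbar (X $ Some i)" "B (y i) (Y $ Some i) = - B pbar (Y $ Some i)"
    "B (X $ Some i) (y i) = - B pbar (X $ Some i)" for i
    using X(3)[of i] Y(3)[of i] B_sym[of "X $ Some i" "y i"] by (auto simp: y_def B_diff)
  have "B pbar (dz Y i) * B (a i) (X $ None) + B pbar (dz X i) * B (a i) (Y $ None) + B (dz X i) (dz Y i) =
      (B (a i) (x $ None))\<^sup>2 * B (X $ Some i) (Y $ Some i)" for i
    unfolding dz_def by (simp add: B_add B_scale yX y(2) power2_eq_square algebra_simps)
  then show ?thesis
    unfolding frechet_derivative_psi warped_metric_def warp_eq y_def[symmetric] dz_def[symmetric]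
      B_sum_W[OF X(1) Y(1) dW] by simp
qed

text \<open>With the other coordinates frozen, \<open>\<psi>\<close> is the homothety sending
  \<open>u\<close> to \<open>c + \<rho> (u - pbar)\<close>. On \<open>W i\<close> the point
  \<open>c\<close> pairs as \<open>\<rho>\<close> times \<open>pbar\<close> does, so the chord
  equation at \<open>pbar\<close> goes over into the one at \<open>c\<close>.\<close>

lemma leaf_Some:
  assumes "z \<in> \<psi> ` P"
  obtains e c where "pole (W i) c e" "z \<in> slice c (W i)"
    "leaf (factors B pbar V a) \<psi> (Some i) z = slice c (W i)"
proof -
  obtain x where x: "x \<in> P" "\<psi> x = z" using assms by blast
  have x': "x $ None \<in> V None" "\<And>i. B (a i) (x $ None) > 0" "\<And>i. x $ Some i \<in> slice pbar (W i)"
    using x by (auto simp: mem_P)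
  define \<rho> where "\<rho> = B (a i) (x $ None)"
  \<comment> \<open>the point of the leaf whose \<open>i\<close>-th coordinate is \<open>pbar\<close>\<close>
  define c where "c = x $ None + (\<Sum>l\<in>UNIV - {i}. B (a l) (x $ None) *\<^sub>R (x $ Some l - pbar))"
  have upd: "\<psi> (vec_upd x (Some i) u) = c + \<rho> *\<^sub>R (u - pbar)" for u
  proof -
    have "(\<Sum>l\<in>UNIV - {i}. B (a l) (x $ None) *\<^sub>R (vec_upd x (Some i) u $ Some l - pbar)) =
        (\<Sum>l\<in>UNIV - {i}. B (a l) (x $ None) *\<^sub>R (x $ Some l - pbar))"
      by (rule sum.cong) (auto simp: vec_upd_nth)
    then show ?thesis
      unfolding psi_eq c_def \<rho>_def by (simp add: sum.remove[of UNIV i] vec_upd_nth)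
  qed
  have Bc: "B c w = B pbar w * \<rho>" if w: "w \<in> W i" for w
  proof -
    have "B (x $ Some l - pbar) w = 0" if "l \<noteq> i" for l
      using W_orth[OF that slice_chord_mem(1)[OF x'(3)] w] .
    then show ?thesis
      unfolding c_def B_add B_sum \<rho>_def using B_None_W[OF x'(1) w] B_sym[of "x $ None" "a i"] by (simp add: B_scale)
  qed
  have \<rho>: "\<rho> > 0" using x'(2) by (simp add: \<rho>_def)
  have "B c v = 0" if "v \<in> V (Some i)" for v
    using Bc[OF V_W[OF that]] B_None_Some(1)[OF pbar_mem that] by simp
  moreover have "B c (a i) \<noteq> 0" using Bc[OF a_W] \<rho> by (simp add: pbar_a)
  ultimately have pole: "pole (W i) c (inverse (B c (a i)) *\<^sub>R a i)" by (rule pole_W)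
  have mem: "c + \<rho> *\<^sub>R y \<in> slice c (W i) \<longleftrightarrow> pbar + y \<in> slice pbar (W i)" for y
  proof -
    have "\<rho> *\<^sub>R y \<in> W i \<longleftrightarrow> y \<in> W i"
      using subspace_scale[OF W_subspace, of "\<rho> *\<^sub>R y" i "inverse \<rho>"] subspace_scale[OF W_subspace, of y i \<rho>] \<rho> by auto
    moreover have "B (c + \<rho> *\<^sub>R y) (c + \<rho> *\<^sub>R y) = B c c \<longleftrightarrow> B y y = - 2 * B pbar y" if "y \<in> W i"
    proof -
      have "B (c + \<rho> *\<^sub>R y) (c + \<rho> *\<^sub>R y) = B c c + \<rho>\<^sup>2 * (B y y + 2 * B pbar y)"
        using Bc[OF that] B_sym[of y c] by (simp add: B_add B_scale power2_eq_square algebra_simps)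
      then show ?thesis using \<rho> by auto
    qed
    ultimately show ?thesis unfolding slice_pbar_iff by (auto simp: slice_def)
  qed
  have "leaf (factors B pbar V a) \<psi> (Some i) z = (\<lambda>u. c + \<rho> *\<^sub>R (u - pbar)) ` slice pbar (W i)"
    unfolding leaf_eq[OF inj_on_psi x] upd factors_Some ..
  also have "\<dots> = slice c (W i)"
  proof (intro equalityI subsetI)
    fix q assume "q \<in> slice c (W i)"
    moreover have q: "q = c + \<rho> *\<^sub>R ((pbar + inverse \<rho> *\<^sub>R (q - c)) - pbar)" using \<rho> by simp
    ultimately have "pbar + inverse \<rho> *\<^sub>R (q - c) \<in> slice pbar (W i)"
      using mem[of "inverse \<rho> *\<^sub>R (q - c)"] by simp
    with q show "q \<in> (\<lambda>u. c + \<rho> *\<^sub>R (u - pbar)) ` slice pbar (W i)" by blast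
  next
    fix q assume "q \<in> (\<lambda>u. c + \<rho> *\<^sub>R (u - pbar)) ` slice pbar (W i)"
    then obtain u where "u \<in> slice pbar (W i)" "q = c + \<rho> *\<^sub>R (u - pbar)" by blast
    with mem[of "u - pbar"] show "q \<in> slice c (W i)" by simp
  qed
  finally have L: "leaf (factors B pbar V a) \<psi> (Some i) z = slice c (W i)" .
  have "vec_upd x (Some i) (x $ Some i) = x" by (simp add: vec_eq_iff vec_upd_nth)
  with upd[of "x $ Some i"] x(2) mem[of "x $ Some i - pbar"] x'(3)[of i] have "z \<in> slice c (W i)" by simp
  with pole L that show ?thesis by blast
qed

lemma spherical_leaf:
  assumes "z \<in> \<psi> ` P" "ambient \<kappa> N" "z \<in> N"
  shows "spherical B N (leaf (factors B pbar V a) \<psi> (Some i) z)"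
proof -
  obtain e c where c: "pole (W i) c e" "z \<in> slice c (W i)"
      "leaf (factors B pbar V a) \<psi> (Some i) z = slice c (W i)"
    using leaf_Some[OF assms(1)] by blast
  from spherical_slice[OF pole_transfer(1)[OF c(1,2)] dim_W(2) assms(2,3)] show ?thesis
    by (simp add: c(3) slice_eq[OF W_subspace c(2)])
qed

text \<open>The first factor is a cone and \<open>\<psi>\<close> is homogeneous of degree one in its
  first coordinate, so the ray \<open>(1 + t) z\<close> stays in the leaf and has velocity
  \<open>z\<close>. The other leaves are re-based at \<open>z\<close>, where the pole pairs to 1
  with \<open>z\<close>.\<close>

lemma canonical_form_at_psi:
  assumes "z \<in> \<psi> ` P"
  shows "canonical_form_at B (factors B pbar V a) \<psi> z"
  unfolding canonical_form_at_def
proof (intro conjI allI)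
  fix i
  obtain e c where c: "pole (W i) c e" "z \<in> slice c (W i)"
      "leaf (factors B pbar V a) \<psi> (Some i) z = slice c (W i)"
    using leaf_Some[OF assms] by blast
  define e' where "e' = e + B e e *\<^sub>R (z - c)"
  note e = pole_transfer(1)[OF c(1,2), folded e'_def]
  have "ambient 0 UNIV" by (simp add: ambient_def)
  from mean_curvature_slice_base[OF e dim_W(2) this UNIV_I]
  show "B z (- mean_curvature B UNIV (leaf (factors B pbar V a) \<psi> (Some i) z) z) = 1"
    unfolding c(3) slice_eq[OF W_subspace c(2)] using poleD(3)[OF e] by simp
next
  obtain x where x: "x \<in> P" "\<psi> x = z" using assms by blast
  then have x': "x $ None \<in> V None" "\<And>i. B (a i) (x $ None) > 0" by (auto simp: mem_P)
  have o: "open {t::real. 1 + t > 0}" by (intro open_Collect_less continuous_intros)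
  show "z \<in> tangent_space (leaf (factors B pbar V a) \<psi> None z) z"
  proof (rule tangent_spaceI[OF o _ _ open_UNIV])
    show "smooth_on {t. 1 + t > 0} (\<lambda>t. (1 + t) *\<^sub>R z)"
      by (intro smooth_on_scaleR smooth_on_add smooth_on_const smooth_on_id o)
    show "((\<lambda>t. (1 + t) *\<^sub>R z) has_vector_derivative z) (at 0)"
      by (auto intro!: derivative_eq_intros)
    fix t :: real assume t: "t \<in> {t. 1 + t > 0}"
    have "\<psi> (vec_upd x None ((1 + t) *\<^sub>R x $ None)) = (1 + t) *\<^sub>R z"
      unfolding x(2)[symmetric] psi_eq by (simp add: vec_upd_nth B_scale scaleR_add_right scaleR_sum_right)
    moreover have "(1 + t) *\<^sub>R x $ None \<in> factors B pbar V a None"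
      using t x' by (simp add: factors_None B_scale subspace_scale V_subspace)
    ultimately show "(1 + t) *\<^sub>R z \<in> leaf (factors B pbar V a) \<psi> None z"
      unfolding leaf_eq[OF inj_on_psi x] by (metis imageI)
  qed auto
qed

end

section \<open>The induced decomposition of the hyperquadric\<close>

locale canonical_data_hyperquadric = canonical_data B pbar V a
  for B :: "'a::euclidean_space \<Rightarrow> 'a \<Rightarrow> real" and pbar :: 'a
    and V :: "'i::finite option \<Rightarrow> 'a set" and a :: "'i \<Rightarrow> 'a" +
  fixes \<kappa> :: real
  assumes kappa: "inverse \<kappa> = B pbar pbar" "B pbar pbar \<noteq> 0"
begin

definition N0 :: "'a set" where "N0 = {p \<in> factors B pbar V a None. B p p = inverse \<kappa>}"
definition U0 :: "'a set" where "U0 = orth B {pbar} \<inter> V None"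
definition N' :: "'i option \<Rightarrow> 'a set" where "N' = (factors B pbar V a)(None := N0)"

abbreviation "P' \<equiv> product_manifold N'"
abbreviation "\<phi> \<equiv> restrict \<psi> P'"

lemma kappa': "\<kappa> = inverse (B pbar pbar)" "\<kappa> \<noteq> 0" "\<kappa> * B pbar pbar = 1"
proof -
  show "\<kappa> \<noteq> 0" using kappa by auto
  then show "\<kappa> = inverse (B pbar pbar)" "\<kappa> * B pbar pbar = 1" by (simp_all add: kappa(1)[symmetric])
qed

lemma ambient_hyperquadric: "ambient \<kappa> (hyperquadric B \<kappa>)" "pbar \<in> hyperquadric B \<kappa>"
  using kappa kappa' by (auto simp: ambient_def hyperquadric_def)

lemma tangent_hyperquadric: "tangent_space (hyperquadric B \<kappa>) pbar = {v. B pbar v = 0}"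
  using tangent_space_ambient[OF ambient_hyperquadric] kappa'(2) by simp

lemma U0_eq: "U0 = {t \<in> V None. B pbar t = 0}"
  using B_sym[of _ pbar] by (auto simp: U0_def orth_def)

lemma subspace_U0: "subspace U0"
  unfolding U0_def by (intro subspace_inter subspace_orth V_subspace)

lemma pole_V0: "pole (V None) pbar (\<kappa> *\<^sub>R pbar)"
  unfolding kappa'(1) by (rule pole_hyperquadric[OF kappa(2) V_subspace pbar_mem V_nondegenerate])

text \<open>The open conditions cutting \<open>N0\<close> out of a full slice, kept apart so that
  the results on \<open>slice p W \<inter> O'\<close> apply.\<close>

definition cone :: "'a set" where "cone = {p. \<forall>i. B (a i) p > 0}"

lemma open_cone: "open cone"
proof -
  have "continuous_on UNIV (B (a i))" for i
    using smooth_on_imp_continuous_on[OF smooth_on_B[OF open_UNIV smooth_on_const smooth_on_id]] .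
  then have "open (\<Inter>i. {p. B (a i) p > 0})"
    by (intro open_INT finite ballI open_Collect_less continuous_on_const)
  moreover have "cone = (\<Inter>i. {p. B (a i) p > 0})" by (auto simp: cone_def)
  ultimately show ?thesis by simp
qed

lemma slice_V0: "slice pbar (V None) = {p \<in> V None. B p p = inverse \<kappa>}"
proof -
  have "p - pbar \<in> V None \<longleftrightarrow> p \<in> V None" for p
    using subspace_add[OF V_subspace _ pbar_mem, of "p - pbar"] subspace_diff[OF V_subspace _ pbar_mem, of p]
    by auto
  then show ?thesis by (simp add: slice_def kappa(1))
qed

lemma N0_eq: "N0 = slice pbar (V None) \<inter> cone"
  unfolding N0_def slice_V0 factors_None cone_def by blast

lemma pbar_N0: "pbar \<in> N0"
  using slice_self[OF V_subspace] by (simp add: N0_eq cone_def pbar_a)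

lemma sphere_data: "hyperquadric_sphere_data B \<kappa> pbar U0 (\<kappa> *\<^sub>R pbar)"
  unfolding hyperquadric_sphere_data_def tangent_hyperquadric
\<comment> \<open>The witness is \<open>z = 0\<close>: the data prescribe vanishing mean curvature
  in the hyperquadric.\<close>
proof (intro conjI bexI[of _ 0])
  show "\<kappa> *\<^sub>R pbar \<noteq> 0" using kappa' kappa(2) by (auto simp: B_zero)
  show "0 \<in> orth B U0 \<inter> {v. B pbar v = 0}" by (simp add: orth_def B_zero)
qed (use ambient_hyperquadric(2) subspace_U0 in \<open>auto simp: U0_eq\<close>)

lemma span_U0: "span (insert (\<kappa> *\<^sub>R pbar) U0) = V None"
proof
  show "span (insert (\<kappa> *\<^sub>R pbar) U0) \<subseteq> V None"
    using pbar_mem by (intro span_minimal V_subspace) (auto simp: U0_eq subspace_scale V_subspace)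
  show "V None \<subseteq> span (insert (\<kappa> *\<^sub>R pbar) U0)"
  proof
    fix x assume x: "x \<in> V None"
    have "x - B pbar x *\<^sub>R (\<kappa> *\<^sub>R pbar) \<in> U0"
      using x pbar_mem kappa'(3) by (auto simp: U0_eq B_diff B_scale intro!: subspace_diff subspace_scale V_subspace)
    then have "(x - B pbar x *\<^sub>R (\<kappa> *\<^sub>R pbar)) + B pbar x *\<^sub>R (\<kappa> *\<^sub>R pbar) \<in> span (insert (\<kappa> *\<^sub>R pbar) U0)"
      by (intro span_add[OF _ span_scale]) (auto intro: span_base)
    then show "x \<in> span (insert (\<kappa> *\<^sub>R pbar) U0)" by simp
  qed
qed

lemma N0_openin: "openin (top_of_set (determined_sphere B pbar U0 (\<kappa> *\<^sub>R pbar))) N0"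
proof -
  have sq: "B (\<kappa> *\<^sub>R pbar) (\<kappa> *\<^sub>R pbar) = \<kappa>" using kappa'(3) by (simp add: B_scale)
  \<comment> \<open>The centre \<open>pbar - (1 / \<kappa>) \<kappa> pbar\<close> is the origin, so
    the sphere is a central slice.\<close>
  have "determined_sphere B pbar U0 (\<kappa> *\<^sub>R pbar) = slice pbar (V None)"
    unfolding determined_sphere_def sq span_U0 slice_V0 using kappa'(2) by (simp add: inverse_eq_divide)
  then show ?thesis unfolding N0_eq using open_cone by (simp add: openin_open_Int)
qed

text \<open>By \<open>psi_square\<close>, restricting the first factor to \<open>N0\<close> is the
  same as restricting the image to the hyperquadric. Openness of the image there then comes from
  \<open>psi_range\<close>.\<close>

lemma P'_eq: "P' = {x \<in> P. B (\<psi> x) (\<psi> x) = inverse \<kappa>}"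
proof -
  have "x \<in> P' \<longleftrightarrow> x \<in> P \<and> B (x $ None) (x $ None) = inverse \<kappa>" for x
    unfolding product_manifold_def by (auto simp: all_option N'_def N0_def)
  then show ?thesis using psi_square by auto
qed

lemma phi_image: "\<phi> ` P' = hyperquadric B \<kappa> \<inter> psi_range"
  unfolding P'_eq psi_image[symmetric] by (auto simp: hyperquadric_def)

lemma inj_on_phi: "inj_on \<phi> P'"
  using inj_on_psi by (auto simp: inj_on_def P'_eq)

lemma pbar_P': "vec pbar \<in> P'" "\<phi> (vec pbar) = pbar"
proof -
  have "pbar \<in> N' j" for j
    using pbar_N0 slice_self[OF W_subspace] by (cases j) (auto simp: N'_def factors_Some)
  then show *: "vec pbar \<in> P'" by (simp add: product_manifold_def)
  then show "\<phi> (vec pbar) = pbar" by (simp add: psi_eq)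
qed

lemma tangent_N':
  assumes "x \<in> P'" "X \<in> tangent_space P' x"
  shows "X $ None \<in> V None" "X $ Some i \<in> W i" "B (x $ Some i) (X $ Some i) = 0"
proof -
  have x: "x $ None \<in> N0" "x $ Some i \<in> slice pbar (W i)"
    using assms(1) by (auto simp: product_manifold_def N'_def all_option factors_Some)
  have "X $ None \<in> tangent_space N0 (x $ None)" "X $ Some i \<in> tangent_space (slice pbar (W i)) (x $ Some i)"
    using tangent_space_product[OF assms(2), of None] tangent_space_product[OF assms(2), of "Some i"]
    by (auto simp: N'_def factors_Some)
  with tangent_space_slice[OF pole_V0 open_cone x(1)[unfolded N0_eq]]
    tangent_space_slice[OF pole_W_pbar open_UNIV, of "x $ Some i" i] x(2)
  show "X $ None \<in> V None" "X $ Some i \<in> W i" "B (x $ Some i) (X $ Some i) = 0"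
    by (auto simp: N0_eq)
qed

lemma isometry_phi:
  "isometry_onto_open (warped_metric B (warp B pbar a)) P' B (hyperquadric B \<kappa>) \<phi>"
  unfolding isometry_onto_open_def
proof (intro conjI ballI)
  show "\<phi> ` P' \<noteq> {}" using pbar_P' by blast
  show "openin (top_of_set (hyperquadric B \<kappa>)) (\<phi> ` P')"
    unfolding phi_image using open_psi_range by (simp add: openin_open_Int)
  show "inj_on \<phi> P'" by (rule inj_on_phi)
  show "smooth_map P' \<phi>" by (rule smooth_mapI[OF open_UNIV smooth_on_psi]) auto
  show "smooth_map (\<phi> ` P') (inv_into P' \<phi>)"
  proof (rule smooth_mapI[OF open_psi_range smooth_on_psi_inv])
    show "\<phi> ` P' \<subseteq> psi_range" unfolding phi_image by blast
    fix y assume "y \<in> \<phi> ` P'"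
    then obtain x where x: "x \<in> P'" "y = \<phi> x" by blast
    then show "psi_inv y = inv_into P' \<phi> y"
      using psi_inv_psi(2)[of x] inv_into_f_f[OF inj_on_phi x(1)] by (simp add: P'_eq)
  qed
  fix x X Y assume x: "x \<in> P'" and XY: "X \<in> tangent_space P' x" "Y \<in> tangent_space P' x"
  \<comment> \<open>\<open>\<psi>\<close> itself is a global smooth extension of its restriction
    \<open>\<phi>\<close>, so its derivative computes the differential.\<close>
  have "local_extension P' \<phi> x \<psi>"
    unfolding local_extension_def using smooth_on_psi by (intro exI[of _ UNIV]) auto
  then have d: "differential P' \<phi> x Z = frechet_derivative \<psi> (at x) Z" if "Z \<in> tangent_space P' x" for Z
    using differential_eq that by blast
  have "x \<in> P" using x by (simp add: P'_eq)
  then show "B (differential P' \<phi> x X) (differential P' \<phi> x Y) = warped_metric B (warp B pbar a) x X Y"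
    unfolding d[OF XY(1)] d[OF XY(2)]
    by (rule psi_isometry[OF _ tangent_N'[OF x XY(1)] tangent_N'[OF x XY(2)]])
qed

lemma warped_product_phi:
  "warped_product_decomposition B N' (warp B pbar a) (hyperquadric B \<kappa>) \<phi>"
  unfolding warped_product_decomposition_def
proof (intro conjI allI ballI)
  show "\<exists>m. pr_submanifold B m (hyperquadric B \<kappa>)" by (rule pr_submanifold_ambient[OF ambient_hyperquadric])
  show "\<exists>m. pr_submanifold B m (N' None)"
    using pr_submanifold_slice[OF pole_V0 open_cone] by (auto simp: N'_def N0_eq)
  fix i
  show "\<exists>m>0. pr_submanifold B m (N' (Some i))"
    using pr_submanifold_slice[OF pole_W_pbar open_UNIV, of i] dim_W(2)[of i]
    by (intro exI[of _ "dim (W i) - 1"]) (simp add: N'_def factors_Some)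
  have "smooth_on UNIV (warp B pbar a i)"
    unfolding warp_def by (intro smooth_on_add smooth_on_B smooth_on_diff smooth_on_const smooth_on_id open_UNIV)
  then show "smooth_map (N' None) (warp B pbar a i)" by (rule smooth_mapI[OF open_UNIV]) auto
  show "warp B pbar a i p > 0" if "p \<in> N' None" for p
    using that by (simp add: N'_def N0_eq cone_def warp_eq)
  show "isometry_onto_open (warped_metric B (warp B pbar a)) P' B (hyperquadric B \<kappa>) \<phi>"
    by (rule isometry_phi)
qed

text \<open>At \<open>pbar\<close> every warping function is 1, and a coordinate equal to
  \<open>pbar\<close> contributes nothing, so \<open>\<phi>\<close> is the identity in each single
  coordinate.\<close>

lemma leaf_phi: "leaf N' \<phi> j pbar = N' j"
proof -
  have "\<phi> (vec_upd (vec pbar) j u) = u" if "u \<in> N' j" for u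
  proof -
    have "vec_upd (vec pbar) j u \<in> P'"
      using pbar_P'(1) that by (simp add: product_manifold_def vec_upd_nth)
    moreover have "\<psi> (vec_upd (vec pbar) j u) = u"
    proof (cases j)
      case (Some i)
      have "\<psi> (vec_upd (vec pbar) j u) = pbar + (\<Sum>l\<in>UNIV. if l = i then u - pbar else 0)"
        unfolding psi_eq Some by (intro arg_cong2[of _ _ _ _ "(+)"] sum.cong) (auto simp: vec_upd_nth pbar_a)
      then show ?thesis by simp
    qed (simp add: psi_eq vec_upd_nth)
    ultimately show ?thesis by simp
  qed
  then show ?thesis unfolding leaf_eq[OF inj_on_phi pbar_P'] by (simp cong: image_cong)
qed

lemma determined_phi:
  "hyperquadric_decomposition_determined_by B \<kappa> N' \<phi> pbar (V(None := U0)) a"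
  unfolding hyperquadric_decomposition_determined_by_def
proof (intro conjI allI)
  show "pbar \<in> \<phi> ` P'" using pbar_P' by (metis imageI)
  show "tangent_space (leaf N' \<phi> j pbar) pbar = (V(None := U0)) j" for j
  proof (cases j)
    case None
    have "pbar \<in> cone" using pbar_N0 by (simp add: N0_eq)
    from tangent_space_slice_base[OF pole_V0 open_cone this] show ?thesis
      unfolding leaf_phi by (simp add: None N'_def N0_eq U0_eq)
  next
    case (Some i)
    have "{w \<in> W i. B pbar w = 0} = V (Some i)"
      by (rule perp_W) (use B_None_Some(1)[OF pbar_mem] pbar_a in auto)
    then show ?thesis
      using tangent_space_slice_base[OF pole_W_pbar[of i] open_UNIV]
      unfolding leaf_phi by (simp add: Some N'_def factors_Some)
  qed
  show "mean_curvature B (hyperquadric B \<kappa>) (leaf N' \<phi> (Some i) pbar) pbar = \<kappa> *\<^sub>R pbar - a i" for i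
    using mean_curvature_slice_base[OF pole_W_pbar dim_W(2) ambient_hyperquadric]
    unfolding leaf_phi by (simp add: N'_def factors_Some)
  show "orthogonal_decomposition B (V(None := U0)) (tangent_space (hyperquadric B \<kappa>) pbar)"
    unfolding orthogonal_decomposition_def tangent_hyperquadric
  proof (intro conjI allI impI ballI)
    let ?V = "V(None := U0)"
    have UV: "x \<in> V j" if "x \<in> ?V j" for x j using that by (auto simp: U0_eq split: if_splits)
    show "subspace (?V j)" for j using V_subspace subspace_U0 by simp
    show "?V j \<subseteq> {v. B pbar v = 0}" for j
      using B_None_Some(1)[OF pbar_mem] by (cases j) (auto simp: U0_eq)
    show "B x y = 0" if "j \<noteq> l" "x \<in> ?V j" "y \<in> ?V l" for j l x y
      using V_orth[OF that(1) UV[OF that(2)] UV[OF that(3)]] .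
    fix x assume "x \<in> {v. B pbar v = 0}"
    \<comment> \<open>Since \<open>pbar \<in> V None\<close>, orthogonality to \<open>pbar\<close>
      concerns the \<open>V None\<close>-component alone; the original components of
      \<open>x\<close> therefore already lie in the smaller subspaces.\<close>
    then have "B pbar (comp None x) = 0" using B_comp[OF pbar_mem, of x] by simp
    then have mem: "comp j x \<in> ?V j" for j using comp_mem by (cases j) (auto simp: U0_eq)
    show "\<exists>!v. (\<forall>j. v j \<in> ?V j) \<and> x = (\<Sum>j\<in>UNIV. v j)"
    proof (rule ex1I)
      show "(\<forall>j. comp j x \<in> ?V j) \<and> x = (\<Sum>j\<in>UNIV. comp j x)" using mem comp_sum by metis
      fix v assume "(\<forall>j. v j \<in> ?V j) \<and> x = (\<Sum>j\<in>UNIV. v j)"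
      then have "comp j x = v j" for j using UV by (intro comp_unique) blast+
      then show "v = (\<lambda>j. comp j x)" by simp
    qed
  qed
qed

end

theorem theorem12p5:
  fixes B :: "'a::euclidean_space \<Rightarrow> 'a \<Rightarrow> real"
    and \<nu> :: nat and \<kappa> :: real and pbar :: 'a
    and V :: "'i::finite option \<Rightarrow> 'a set" and a :: "'i \<Rightarrow> 'a"
  defines "\<rho> \<equiv> warp B pbar a"
    and "N \<equiv> factors B pbar V a"
    and "\<psi> \<equiv> associated_map B pbar a"
  defines "N0\<kappa> \<equiv> {p \<in> N None. B p p = inverse \<kappa>}"
    and "U0 \<equiv> orth B {pbar} \<inter> V None"
  defines "N' \<equiv> N(None := N0\<kappa>)"
  defines "\<phi> \<equiv> restrict \<psi> (product_manifold N')"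
  assumes "DIM('a) \<ge> 2" and "pseudo_euclidean \<nu> B"
    and "initial_data B pbar V a" and "canonical_form B pbar V a"
    and "inverse \<kappa> = B pbar pbar" and "B pbar pbar \<noteq> 0"
  shows "hyperquadric_sphere_data B \<kappa> pbar U0 (\<kappa> *\<^sub>R pbar)
       \<and> openin (top_of_set (determined_sphere B pbar U0 (\<kappa> *\<^sub>R pbar))) N0\<kappa>
       \<and> warped_product_decomposition B N' \<rho> (hyperquadric B \<kappa>) \<phi>
       \<and> hyperquadric_decomposition_determined_by B \<kappa> N' \<phi> pbar (V(None := U0)) a
       \<and> (\<forall>p \<in> \<psi> ` product_manifold N. B p p \<noteq> 0 \<longrightarrow>
            (\<forall>i. spherical B UNIV (leaf N \<psi> (Some i) p)
               \<and> spherical B (hyperquadric B (1 / B p p)) (leaf N \<psi> (Some i) p)))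
       \<and> (\<forall>p \<in> \<psi> ` product_manifold N. canonical_form_at B N \<psi> p)"
proof -
  interpret D: canonical_data_hyperquadric B pbar V a \<kappa>
    using assms(9-13) by unfold_locales (auto simp: pseudo_euclidean_def)
  have defs: "D.N0 = N0\<kappa>" "D.U0 = U0" "D.N' = N'"
    unfolding D.N0_def D.U0_def D.N'_def N0\<kappa>_def U0_def N'_def N_def by simp_all
  \<comment> \<open>One lemma serves both claims: \<open>ambient\<close> with curvature 0 is the
    flat space, with curvature \<open>1 / B p p\<close> the hyperquadric through
    \<open>p\<close>.\<close>
  have sph: "spherical B UNIV (leaf N \<psi> (Some i) p) \<and> spherical B (hyperquadric B (1 / B p p)) (leaf N \<psi> (Some i) p)"
    if "p \<in> \<psi> ` product_manifold N" "B p p \<noteq> 0" for p i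
    using D.spherical_leaf[of p 0 UNIV i] D.spherical_leaf[of p "1 / B p p" "hyperquadric B (1 / B p p)" i] that
    unfolding N_def \<psi>_def by (simp add: D.ambient_def hyperquadric_def)
  show ?thesis
    using D.sphere_data D.N0_openin D.warped_product_phi D.determined_phi D.canonical_form_at_psi sph
    unfolding defs N_def \<psi>_def \<phi>_def \<rho>_def by simp
qed

end
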